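(* For all sets $\Gamma,\Delta\subseteq\mathcal{L}$ and every individual variable $x$, we have $\Gamma\models\Delta$ (i.e. no pointed Chellas model satisfies all of $\Gamma$ and none of $\Delta$) if and only if $Th\cup\{ST_x(\phi)\mid\phi\in\Gamma\}\models_{fo}\{ST_x(\psi)\mid\psi\in\Delta\}$.
   Context: Propositional side: $\mathcal{L}$ is built from a countably infinite set $Var$ of propositional variables and $\top,\bot$ by $\wedge,\vee,\to$ and conditional connectives $\phi\mathbin{\Box\!\!\to}\psi$, $\phi\mathbin{\Diamond\!\!\to}\psi$. A Chellas model is $\mathcal{M}=(W,\leq,R,V)$: $W\neq\emptyset$, $\leq$ a preorder on $W$, $V:Var\to\mathcal{P}(W)$ with upward-closed values, $R\subseteq W\times\mathcal{P}(W)\times W$ with $R_X(w,v)$ meaning $(w,X,v)\in R$, such that for all $X\subseteq W$: (c1) if $w\leq w'$ and $R_X(w,v)$ then $R_X(w',v')$ and $v\leq v'$ for some $v'$; (c2) if $R_X(w,v)$ and $v\leq v'$ then $w\leq w'$ and $R_X(w',v')$ for some $w'$. Satisfaction: $\top$ true, $\bot$ false, $p$ true at $w$ iff $w\in V(p)$, $\wedge,\vee$ pointwise, $\psi\to\chi$ true at $w$ iff at every $v\geq w$ truth of $\psi$ implies truth of $\chi$; $\psi\mathbin{\Box\!\!\to}\chi$ true at $w$ iff $\chi$ is true at every $u$ with $R_{\|\psi\|}(v,u)$ for some $v\geq w$; $\psi\mathbin{\Diamond\!\!\to}\chi$ true at $w$ iff $\chi$ is true at some $u$ with $R_{\|\psi\|}(w,u)$,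 where $\|\psi\|$ is the set of worlds where $\psi$ is true. First-order side: $\mathcal{L}_{fo}$ has individual variables $Ind$, atoms $px$ ($p\in Var$), $Rxyz$, $Ox$, $Sx$, $Exy$, $x\equiv y$, $\top,\bot$, connectives $\wedge,\vee,\to$ and quantifiers $\forall,\exists$; $\neg\phi:=\phi\to\bot$, $\leftrightarrow$ as usual, and $(\forall x)_O\phi:=\forall x(Ox\to\phi)$. A Kripke sheaf is $(W,\leq,\mathfrak{A},\mathbb{H})$: $W\neq\emptyset$, $\leq$ a preorder, each $w$ has a classical structure $\mathfrak{A}_w$ with nonempty domain $A_w$ interpreting each $p$, $O$, $S$ as unary, $E$ as binary and $R$ as ternary relations, and for $w\leq v$ a homomorphism $\mathbb{H}_{wv}:\mathfrak{A}_w\to\mathfrak{A}_v$ with $\mathbb{H}_{ww}$ the identity and $\mathbb{H}_{wu}(a)=\mathbb{H}_{vu}(\mathbb{H}_{wv}(a))$ for $w\leq v\leq u$. For an assignment $f:Ind\to A_w$: atoms are evaluated classically in $\mathfrak{A}_w$ ($\equiv$ as identity), $\wedge,\vee$ locally, $\psi\to\chi$ holds at $(w,f)$ iff for all $v\geq w$, $\psi$ at $(v,\mathbb{H}_{wv}\circ f)$ implies $\chi$ at $(v,\mathbb{H}_{wv}\circ f)$; $\exists x\psi$ iff $\psi$ holds at $(w,f[x/a])$ for some $a\in A_w$; $\forall x\psi$ iff $\psi$ holds at $(v,(\mathbb{H}_{wv}\circ f)[x/a])$ for all $v\geq w$, $a\in A_v$. $\Sigma\models_{fo}\Pi$ iff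 there is no Kripke sheaf, world $w$ and assignment at $w$ making all of $\Sigma$ true and all of $\Pi$ false. $Th$ consists of: $\forall x(Sx\vee Ox)$; $\forall x\neg(Sx\wedge Ox)$; $\forall x(px\to Ox)$ for $p\in Var$; $\forall x\forall y(Exy\to(Ox\wedge Sy))$; $\forall x\forall y\forall z(Rxyz\to(Ox\wedge Sy\wedge Oz))$; $\exists x(Sx\wedge\forall y(Eyx\leftrightarrow py))$ for $p\in Var$; $\exists x(Sx\wedge(\forall y)_O Eyx)$; $\exists x(Sx\wedge\forall y\neg Eyx)$; $\forall x\forall y((Sx\wedge Sy)\to\exists z(Sz\wedge(\forall w)_O(Ewz\leftrightarrow(Ewx\ast Ewy))))$ for $\ast\in\{\wedge,\vee,\to\}$; $\forall x\forall y((Sx\wedge Sy)\to\exists z(Sz\wedge(\forall w)_O(Ewz\leftrightarrow\forall u(Rwxu\to Euy))))$; $\forall x\forall y((Sx\wedge Sy)\to\exists z(Sz\wedge(\forall w)_O(Ewz\leftrightarrow\exists u(Rwxu\wedge Euy))))$; $\forall x\forall y((Sx\wedge Sy\wedge(\forall z)_O(Ezx\leftrightarrow Ezy))\to x\equiv y)$. Standard translation (with $x,y,z,w$ pairwise distinct): $ST_x(p)=px$; $ST_x(\top)=\top$, $ST_x(\bot)=\bot$; $ST_x(\psi\ast\chi)=ST_x(\psi)\ast ST_x(\chi)$ for $\ast\in\{\wedge,\vee,\to\}$; $ST_x(\psi\mathbin{\Box\!\!\to}\chi)=\exists y(Sy\wedge(\forall z)_O(Ezy\leftrightarrow ST_z(\psi))\wedge\forall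 w(Rxyw\to ST_w(\chi)))$; $ST_x(\psi\mathbin{\Diamond\!\!\to}\chi)=\exists y(Sy\wedge(\forall z)_O(Ezy\leftrightarrow ST_z(\psi))\wedge\exists w(Rxyw\wedge ST_w(\chi)))$. *)

theory Defs
  imports "HOL-Library.Infinite_Typeclass"
begin

section \<open>Intuitionistic conditional logic\<close>

type_synonym pvar = nat
type_synonym ivar = nat

datatype fm =
    Top
  | Bot
  | Var pvar
  | Conj fm fm
  | Disj fm fm
  | Impl fm fm
  | BoxTo fm fm
  | DiaTo fm fm

record 'w chellas =
  worlds :: "'w set"
  le :: "'w rel"
  acc :: "('w \<times> 'w set \<times> 'w) set"
  val :: "pvar \<Rightarrow> 'w set"

definition chellas_model :: "'w chellas \<Rightarrow> bool" where
  "chellas_model M \<longleftrightarrow>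
     worlds M \<noteq> {} \<and>
     preorder_on (worlds M) (le M) \<and>
     acc M \<subseteq> worlds M \<times> Pow (worlds M) \<times> worlds M \<and>
     (\<forall>p. val M p \<subseteq> worlds M) \<and>
     (\<forall>p w v. w \<in> val M p \<and> (w, v) \<in> le M \<longrightarrow> v \<in> val M p) \<and>
     (\<forall>X w w' v. X \<subseteq> worlds M \<and> (w, w') \<in> le M \<and> (w, X, v) \<in> acc M \<longrightarrow>
        (\<exists>v'. (w', X, v') \<in> acc M \<and> (v, v') \<in> le M)) \<and>
     (\<forall>X w v v'. X \<subseteq> worlds M \<and> (w, X, v) \<in> acc M \<and> (v, v') \<in> le M \<longrightarrow>
        (\<exists>w'. (w, w') \<in> le M \<and> (w', X, v') \<in> acc M))"

primrec sat :: "'w chellas \<Rightarrow> fm \<Rightarrow> 'w \<Rightarrow> bool" where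
  "sat M Top w \<longleftrightarrow> True"
| "sat M Bot w \<longleftrightarrow> False"
| "sat M (Var p) w \<longleftrightarrow> w \<in> val M p"
| "sat M (Conj \<phi> \<psi>) w \<longleftrightarrow> sat M \<phi> w \<and> sat M \<psi> w"
| "sat M (Disj \<phi> \<psi>) w \<longleftrightarrow> sat M \<phi> w \<or> sat M \<psi> w"
| "sat M (Impl \<phi> \<psi>) w \<longleftrightarrow> (\<forall>v. (w, v) \<in> le M \<longrightarrow> sat M \<phi> v \<longrightarrow> sat M \<psi> v)"
| "sat M (BoxTo \<phi> \<psi>) w \<longleftrightarrow>
     (\<forall>v u. (w, v) \<in> le M \<longrightarrow> (v, {z \<in> worlds M. sat M \<phi> z}, u) \<in> acc M \<longrightarrow> sat M \<psi> u)"
| "sat M (DiaTo \<phi> \<psi>) w \<longleftrightarrow>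
     (\<exists>u. (w, {z \<in> worlds M. sat M \<phi> z}, u) \<in> acc M \<and> sat M \<psi> u)"

text \<open>
  HOL cannot quantify over all types inside a proposition, so consequence is relative to the
  type from which the worlds of a model are drawn (for Kripke sheaves: the types of worlds and of
  individuals). Carriers are arbitrary nonempty subsets of these types. The types should be
  infinite: over a finite type there are too few models, whereas every structure embeds into one
  over an infinite type.
\<close>

definition chellas_entails :: "'w itself \<Rightarrow> fm set \<Rightarrow> fm set \<Rightarrow> bool" where
  "chellas_entails _ \<Gamma> \<Delta> \<longleftrightarrow>
     \<not> (\<exists>(M :: 'w chellas) w. chellas_model M \<and> w \<in> worlds M \<and>
          (\<forall>\<phi>\<in>\<Gamma>. sat M \<phi> w) \<and> (\<forall>\<psi>\<in>\<Delta>. \<not> sat M \<psi> w))"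

section \<open>Intuitionistic first-order logic over Kripke sheaves\<close>

datatype fo =
    FTop (\<open>\<^bold>\<top>\<close>)
  | FBot (\<open>\<^bold>\<bottom>\<close>)
  | PredA pvar ivar
  | RelA ivar ivar ivar
  | ObjA ivar
  | SetA ivar
  | ElemA ivar ivar
  | EqA ivar ivar (infix \<open>\<^bold>\<equiv>\<close> 70)
  | FAnd fo fo (infixr \<open>\<^bold>\<and>\<close> 65)
  | FOr fo fo (infixr \<open>\<^bold>\<or>\<close> 60)
  | FImp fo fo (infixr \<open>\<^bold>\<longrightarrow>\<close> 55)
  | FAll ivar fo
  | FEx ivar fo

abbreviation FNot :: "fo \<Rightarrow> fo" (\<open>\<^bold>\<not> _\<close> [67] 67) where
  "\<^bold>\<not> \<phi> \<equiv> \<phi> \<^bold>\<longrightarrow> \<^bold>\<bottom>"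

abbreviation FIff :: "fo \<Rightarrow> fo \<Rightarrow> fo" (infixr \<open>\<^bold>\<longleftrightarrow>\<close> 52) where
  "\<phi> \<^bold>\<longleftrightarrow> \<psi> \<equiv> (\<phi> \<^bold>\<longrightarrow> \<psi>) \<^bold>\<and> (\<psi> \<^bold>\<longrightarrow> \<phi>)"

abbreviation FAllO :: "ivar \<Rightarrow> fo \<Rightarrow> fo" where
  "FAllO x \<phi> \<equiv> FAll x (ObjA x \<^bold>\<longrightarrow> \<phi>)"

record 'a struct =
  dom :: "'a set"
  predI :: "pvar \<Rightarrow> 'a set"
  objI :: "'a set"
  setI :: "'a set"
  elemI :: "('a \<times> 'a) set"
  relI :: "('a \<times> 'a \<times> 'a) set"

definition classical_structure :: "'a struct \<Rightarrow> bool" where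
  "classical_structure A \<longleftrightarrow>
     dom A \<noteq> {} \<and>
     (\<forall>p. predI A p \<subseteq> dom A) \<and> objI A \<subseteq> dom A \<and> setI A \<subseteq> dom A \<and>
     elemI A \<subseteq> dom A \<times> dom A \<and> relI A \<subseteq> dom A \<times> dom A \<times> dom A"

definition homomorphism :: "'a struct \<Rightarrow> 'a struct \<Rightarrow> ('a \<Rightarrow> 'a) \<Rightarrow> bool" where
  "homomorphism A B h \<longleftrightarrow>
     (\<forall>a\<in>dom A. h a \<in> dom B) \<and>
     (\<forall>p. \<forall>a\<in>predI A p. h a \<in> predI B p) \<and>
     (\<forall>a\<in>objI A. h a \<in> objI B) \<and>
     (\<forall>a\<in>setI A. h a \<in> setI B) \<and>
     (\<forall>(a, b)\<in>elemI A. (h a, h b) \<in> elemI B) \<and>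
     (\<forall>(a, b, c)\<in>relI A. (h a, h b, h c) \<in> relI B)"

record ('v, 'a) sheaf =
  nodes :: "'v set"
  ord :: "'v rel"
  str :: "'v \<Rightarrow> 'a struct"
  hom :: "'v \<Rightarrow> 'v \<Rightarrow> 'a \<Rightarrow> 'a"

definition kripke_sheaf :: "('v, 'a) sheaf \<Rightarrow> bool" where
  "kripke_sheaf K \<longleftrightarrow>
     nodes K \<noteq> {} \<and>
     preorder_on (nodes K) (ord K) \<and>
     (\<forall>w\<in>nodes K. classical_structure (str K w)) \<and>
     (\<forall>w v. (w, v) \<in> ord K \<longrightarrow> homomorphism (str K w) (str K v) (hom K w v)) \<and>
     (\<forall>w\<in>nodes K. \<forall>a\<in>dom (str K w). hom K w w a = a) \<and>
     (\<forall>w v u. (w, v) \<in> ord K \<and> (v, u) \<in> ord K \<longrightarrow>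
        (\<forall>a\<in>dom (str K w). hom K w u a = hom K v u (hom K w v a)))"

primrec fosat :: "('v, 'a) sheaf \<Rightarrow> fo \<Rightarrow> 'v \<Rightarrow> (ivar \<Rightarrow> 'a) \<Rightarrow> bool" where
  "fosat K \<^bold>\<top> w f \<longleftrightarrow> True"
| "fosat K \<^bold>\<bottom> w f \<longleftrightarrow> False"
| "fosat K (PredA p x) w f \<longleftrightarrow> f x \<in> predI (str K w) p"
| "fosat K (RelA x y z) w f \<longleftrightarrow> (f x, f y, f z) \<in> relI (str K w)"
| "fosat K (ObjA x) w f \<longleftrightarrow> f x \<in> objI (str K w)"
| "fosat K (SetA x) w f \<longleftrightarrow> f x \<in> setI (str K w)"
| "fosat K (ElemA x y) w f \<longleftrightarrow> (f x, f y) \<in> elemI (str K w)"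
| "fosat K (x \<^bold>\<equiv> y) w f \<longleftrightarrow> f x = f y"
| "fosat K (\<phi> \<^bold>\<and> \<psi>) w f \<longleftrightarrow> fosat K \<phi> w f \<and> fosat K \<psi> w f"
| "fosat K (\<phi> \<^bold>\<or> \<psi>) w f \<longleftrightarrow> fosat K \<phi> w f \<or> fosat K \<psi> w f"
| "fosat K (\<phi> \<^bold>\<longrightarrow> \<psi>) w f \<longleftrightarrow>
     (\<forall>v. (w, v) \<in> ord K \<longrightarrow> fosat K \<phi> v (hom K w v \<circ> f) \<longrightarrow> fosat K \<psi> v (hom K w v \<circ> f))"
| "fosat K (FAll x \<phi>) w f \<longleftrightarrow>
     (\<forall>v. (w, v) \<in> ord K \<longrightarrow> (\<forall>a\<in>dom (str K v). fosat K \<phi> v ((hom K w v \<circ> f)(x := a))))"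
| "fosat K (FEx x \<phi>) w f \<longleftrightarrow> (\<exists>a\<in>dom (str K w). fosat K \<phi> w (f(x := a)))"

definition fo_entails :: "'v itself \<Rightarrow> 'a itself \<Rightarrow> fo set \<Rightarrow> fo set \<Rightarrow> bool" where
  "fo_entails _ _ \<Sigma> \<Pi> \<longleftrightarrow>
     \<not> (\<exists>(K :: ('v, 'a) sheaf) w f. kripke_sheaf K \<and> w \<in> nodes K \<and>
          (\<forall>x. f x \<in> dom (str K w)) \<and>
          (\<forall>\<phi>\<in>\<Sigma>. fosat K \<phi> w f) \<and> (\<forall>\<psi>\<in>\<Pi>. \<not> fosat K \<psi> w f))"

section \<open>The theory and the standard translation\<close>

definition Th :: "fo set" where
  "Th = (let x = 0; y = 1; z = 2; w = 3; u = 4 in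
     {FAll x (SetA x \<^bold>\<or> ObjA x),
      FAll x (\<^bold>\<not> (SetA x \<^bold>\<and> ObjA x))}
     \<union> range (\<lambda>p. FAll x (PredA p x \<^bold>\<longrightarrow> ObjA x))
     \<union> {FAll x (FAll y (ElemA x y \<^bold>\<longrightarrow> (ObjA x \<^bold>\<and> SetA y))),
        FAll x (FAll y (FAll z (RelA x y z \<^bold>\<longrightarrow> (ObjA x \<^bold>\<and> SetA y \<^bold>\<and> ObjA z))))}
     \<union> range (\<lambda>p. FEx x (SetA x \<^bold>\<and> FAll y (ElemA y x \<^bold>\<longleftrightarrow> PredA p y)))
     \<union> {FEx x (SetA x \<^bold>\<and> FAllO y (ElemA y x)),
        FEx x (SetA x \<^bold>\<and> FAll y (\<^bold>\<not> (ElemA y x)))}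
     \<union> (\<lambda>c. FAll x (FAll y ((SetA x \<^bold>\<and> SetA y) \<^bold>\<longrightarrow>
            FEx z (SetA z \<^bold>\<and> FAllO w (ElemA w z \<^bold>\<longleftrightarrow> c (ElemA w x) (ElemA w y))))))
          ` {FAnd, FOr, FImp}
     \<union> {FAll x (FAll y ((SetA x \<^bold>\<and> SetA y) \<^bold>\<longrightarrow>
          FEx z (SetA z \<^bold>\<and> FAllO w
            (ElemA w z \<^bold>\<longleftrightarrow> FAll u (RelA w x u \<^bold>\<longrightarrow> ElemA u y))))),
        FAll x (FAll y ((SetA x \<^bold>\<and> SetA y) \<^bold>\<longrightarrow>
          FEx z (SetA z \<^bold>\<and> FAllO w
            (ElemA w z \<^bold>\<longleftrightarrow> FEx u (RelA w x u \<^bold>\<and> ElemA u y))))),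
        FAll x (FAll y ((SetA x \<^bold>\<and> SetA y \<^bold>\<and>
          FAllO z (ElemA z x \<^bold>\<longleftrightarrow> ElemA z y)) \<^bold>\<longrightarrow> x \<^bold>\<equiv> y))})"

text \<open>
  The bound variables of the conditional clauses only have to be distinct from each other and
  from \<open>x\<close>. A fixed choice suffices, since \<open>x\<close> is the only variable that can be free in
  \<open>ST x \<phi>\<close>.
\<close>

primrec ST :: "ivar \<Rightarrow> fm \<Rightarrow> fo" where
  "ST x Top = \<^bold>\<top>"
| "ST x Bot = \<^bold>\<bottom>"
| "ST x (Var p) = PredA p x"
| "ST x (Conj \<phi> \<psi>) = ST x \<phi> \<^bold>\<and> ST x \<psi>"
| "ST x (Disj \<phi> \<psi>) = ST x \<phi> \<^bold>\<or> ST x \<psi>"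
| "ST x (Impl \<phi> \<psi>) = ST x \<phi> \<^bold>\<longrightarrow> ST x \<psi>"
| "ST x (BoxTo \<phi> \<psi>) = (let y = x + 1; z = x + 2; w = x + 3 in
     FEx y (SetA y \<^bold>\<and> FAllO z (ElemA z y \<^bold>\<longleftrightarrow> ST z \<phi>) \<^bold>\<and>
            FAll w (RelA x y w \<^bold>\<longrightarrow> ST w \<psi>)))"
| "ST x (DiaTo \<phi> \<psi>) = (let y = x + 1; z = x + 2; w = x + 3 in
     FEx y (SetA y \<^bold>\<and> FAllO z (ElemA z y \<^bold>\<longleftrightarrow> ST z \<phi>) \<^bold>\<and>
            FEx w (RelA x y w \<^bold>\<and> ST w \<psi>)))"

end

theory Submission
  imports Defs "HOL-Library.Countable_Set"
begin

text \<open>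
  Countermodels are translated in both directions. A Kripke sheaf satisfying \<open>Th\<close> becomes a
  Chellas model on the pairs of a node \<open>v\<close> and an individual over \<open>v\<close>: the comprehension axioms
  provide a set element for every truth set, and extensionality makes it unique.

  Conversely, a Chellas model is first made countable by a Loewenheim-Skolem argument, because the
  worlds, nodes and individuals range over unrelated infinite types. A node of the sheaf then
  places a tree of objects at worlds, respecting the accessibility relations. Moving one object
  to a higher world drags its ancestors along by (c2) and its descendants by (c1), so every step
  upwards in the model is realised by a step upwards in the sheaf. The set elements are the truth
  sets.
\<close>

text \<open>The obstacle in the second direction is that (c1) and (c2) only assert that some
  matching world exists, whereas a transition of a sheaf is one function that must compose along the
  order. With the worlds themselves as individuals, every move upwards would need a coherent choice
  of where all successors go. Objects are therefore kept apart from worlds: they retain their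
  identity, and a node merely records where each of them sits. The tree shape keeps the choices from
  colliding. An object has at most one predecessor, so (c2) is applied along a single chain down to
  a root and (c1) outwards from it, and no two requirements meet at the same object. In the first
  direction no such choices arise, because a homomorphism moves both ends of an edge at once.
  Placements are functions on an infinite set of paths, so a second closure argument is needed to
  extract countably many nodes.\<close>

instance fm :: countable
  by countable_datatype

section \<open>Closure under countably many witness demands, and codings of countable sets\<close>

text \<open>Each stage adds a chosen witness for every index and every triple of earlier points; the
  union is closed because a given triple already lies in one finite stage. It is used for the worlds
  of a Chellas model and again for the nodes of a sheaf.\<close>

lemma countable_closure:
  fixes Q :: "'i::countable \<Rightarrow> 'u \<Rightarrow> 'u \<Rightarrow> 'u \<Rightarrow> 'u \<Rightarrow> bool"
  assumes "countable A" "A \<subseteq> W"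
  obtains B where "countable B" "A \<subseteq> B" "B \<subseteq> W"
    "\<forall>i. \<forall>a\<in>B. \<forall>b\<in>B. \<forall>c\<in>B. \<forall>d\<in>W. Q i a b c d \<longrightarrow> (\<exists>d\<in>B. Q i a b c d)"
proof -
  define P where "P t d \<longleftrightarrow> (case t of (i, a, b, c) \<Rightarrow> d \<in> W \<and> Q i a b c d)" for t d
  define step where "step X = X \<union> (\<lambda>t. SOME d. P t d) ` {t \<in> UNIV \<times> X \<times> X \<times> X. \<exists>d. P t d}" for X
  define C where "C n = (step ^^ n) A" for n
  have C0: "C 0 = A" and CS: "C (Suc n) = step (C n)" for n
    by (simp_all add: C_def)
  have choice: "P t (SOME d. P t d)" if "\<exists>d. P t d" for t
    using that by (rule someI_ex)
  have cnt: "countable (C n)" for n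
  proof (induction n)
    case (Suc n)
    then have "countable ((UNIV :: 'i set) \<times> C n \<times> C n \<times> C n)" by simp
    then have "countable {t \<in> UNIV \<times> C n \<times> C n \<times> C n. \<exists>d. P t d}"
      by (rule countable_subset[rotated]) blast
    then show ?case
      using Suc by (simp add: CS step_def)
  qed (simp add: C0 assms)
  have sub: "C n \<subseteq> W" for n
  proof (induction n)
    case (Suc n)
    have "(SOME d. P t d) \<in> W" if "\<exists>d. P t d" for t
      using choice[OF that] by (auto simp: P_def split: prod.splits)
    then show ?case
      unfolding CS step_def using Suc by blast
  qed (simp add: C0 assms)
  have mono: "C m \<subseteq> C n" if "m \<le> n" for m n
    using that by (rule lift_Suc_mono_le[rotated]) (auto simp: CS step_def)
  let ?B = "\<Union>n. C n"
  show ?thesis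
  proof (rule that[of ?B])
    show "countable (\<Union>n. C n)" using cnt by simp
    show "A \<subseteq> (\<Union>n. C n)" using C0 by blast
    show "(\<Union>n. C n) \<subseteq> W" using sub by blast
    show "\<forall>i. \<forall>a\<in>?B. \<forall>b\<in>?B. \<forall>c\<in>?B. \<forall>d\<in>W. Q i a b c d \<longrightarrow> (\<exists>d\<in>?B. Q i a b c d)"
    proof (intro allI ballI impI)
      fix i a b c d
      assume Q: "d \<in> W" "Q i a b c d" and "a \<in> (\<Union>n. C n)" "b \<in> (\<Union>n. C n)" "c \<in> (\<Union>n. C n)"
      then obtain j k l where "a \<in> C j" "b \<in> C k" "c \<in> C l" by blast
      then have "a \<in> C (j + k + l)" "b \<in> C (j + k + l)" "c \<in> C (j + k + l)"
        using mono[of j "j + k + l"] mono[of k "j + k + l"] mono[of l "j + k + l"] by auto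
      then have *: "(i, a, b, c) \<in> UNIV \<times> C (j + k + l) \<times> C (j + k + l) \<times> C (j + k + l)"
        by simp
      have ex: "\<exists>d. P (i, a, b, c) d" using Q by (auto simp: P_def)
      have "(SOME d. P (i, a, b, c) d) \<in> C (Suc (j + k + l))"
        unfolding CS step_def using * ex by blast
      moreover have "Q i a b c (SOME d. P (i, a, b, c) d)"
        using choice[OF ex] by (simp add: P_def)
      ultimately show "\<exists>d\<in>(\<Union>n. C n). Q i a b c d" by blast
    qed
  qed
qed

lemma countable_inj_on:
  assumes "countable B"
  obtains e :: "'x \<Rightarrow> 'y::infinite" where "inj_on e B"
proof -
  obtain g :: "nat \<Rightarrow> 'y" where "inj g"
    using infinite_countable_subset[OF infinite_UNIV] by blast
  then have "inj_on (g \<circ> to_nat_on B) B"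
    using assms by (intro comp_inj_on inj_on_to_nat_on) (auto intro: inj_on_subset)
  then show ?thesis by (rule that)
qed

section \<open>Chellas models\<close>

abbreviation truth_set :: "'w chellas \<Rightarrow> fm \<Rightarrow> 'w set" where
  "truth_set M \<phi> \<equiv> {z \<in> worlds M. sat M \<phi> z}"

locale chellas =
  fixes M :: "'w chellas"
  assumes model: "chellas_model M"
begin

lemma le_worlds: "(w, v) \<in> le M \<Longrightarrow> w \<in> worlds M \<and> v \<in> worlds M"
  using model by (auto simp: chellas_model_def preorder_on_def)

lemma le_refl: "w \<in> worlds M \<Longrightarrow> (w, w) \<in> le M"
  using model by (auto simp: chellas_model_def preorder_on_def refl_on_def)

lemma le_trans: "(w, v) \<in> le M \<Longrightarrow> (v, u) \<in> le M \<Longrightarrow> (w, u) \<in> le M"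
proof -
  have "trans (le M)"
    using model unfolding chellas_model_def preorder_on_def by (elim conjE)
  then show "(w, v) \<in> le M \<Longrightarrow> (v, u) \<in> le M \<Longrightarrow> (w, u) \<in> le M" by (rule transD)
qed

lemma acc_worlds: "(w, X, v) \<in> acc M \<Longrightarrow> w \<in> worlds M \<and> X \<subseteq> worlds M \<and> v \<in> worlds M"
  using model by (auto simp: chellas_model_def)

lemma val_mono: "w \<in> val M p \<Longrightarrow> (w, v) \<in> le M \<Longrightarrow> v \<in> val M p"
proof -
  have "\<forall>p w v. w \<in> val M p \<and> (w, v) \<in> le M \<longrightarrow> v \<in> val M p"
    using model unfolding chellas_model_def by (elim conjE)
  then show "w \<in> val M p \<Longrightarrow> (w, v) \<in> le M \<Longrightarrow> v \<in> val M p" by blast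
qed

lemma acc_up:
  assumes "(w, w') \<in> le M" "(w, X, v) \<in> acc M"
  obtains v' where "(w', X, v') \<in> acc M" "(v, v') \<in> le M"
proof -
  have "\<forall>X w w' v. X \<subseteq> worlds M \<and> (w, w') \<in> le M \<and> (w, X, v) \<in> acc M \<longrightarrow>
      (\<exists>v'. (w', X, v') \<in> acc M \<and> (v, v') \<in> le M)"
    using model unfolding chellas_model_def by (elim conjE)
  then show ?thesis using assms acc_worlds[OF assms(2)] that by blast
qed

lemma acc_down:
  assumes "(w, X, v) \<in> acc M" "(v, v') \<in> le M"
  obtains w' where "(w, w') \<in> le M" "(w', X, v') \<in> acc M"
proof -
  have "\<forall>X w v v'. X \<subseteq> worlds M \<and> (w, X, v) \<in> acc M \<and> (v, v') \<in> le M \<longrightarrow>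
      (\<exists>w'. (w, w') \<in> le M \<and> (w', X, v') \<in> acc M)"
    using model unfolding chellas_model_def by (elim conjE)
  then show ?thesis using assms acc_worlds[OF assms(1)] that by blast
qed

text \<open>The diamond is the case that rests on a frame condition: (c1) carries its successor
  upwards. The box already quantifies over all higher worlds, so transitivity suffices
  there.\<close>

lemma sat_mono: "sat M \<phi> w \<Longrightarrow> (w, v) \<in> le M \<Longrightarrow> sat M \<phi> v"
proof (induction \<phi> arbitrary: w v)
  case (Var p)
  then show ?case by (auto intro: val_mono)
next
  case (Conj \<phi> \<psi>)
  then show ?case unfolding sat.simps by blast
next
  case (Disj \<phi> \<psi>)
  then show ?case unfolding sat.simps by blast
next
  case (Impl \<phi> \<psi>)
  then show ?case unfolding sat.simps by (blast intro: le_trans)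
next
  case (BoxTo \<phi> \<psi>)
  then show ?case unfolding sat.simps by (blast intro: le_trans)
next
  case (DiaTo \<phi> \<psi>)
  then show ?case unfolding sat.simps by (blast elim: acc_up)
qed simp_all

text \<open>
  Downward Loewenheim-Skolem. Only the relations indexed by truth sets matter, and these are
  countably many; distinct truth sets are kept apart by a witness, so that the restricted truth
  sets can still serve as indices.
\<close>

lemma countable_submodel:
  assumes "w \<in> worlds M"
  obtains N :: "'u::infinite chellas" and w' where "chellas_model N" "w' \<in> worlds N"
    "\<forall>\<phi>. sat N \<phi> w' \<longleftrightarrow> sat M \<phi> w"
proof -
  let ?T = "truth_set M"
  \<comment> \<open>The list collects the witness demands, selected by \<open>k\<close>. Entries 0
    and 1 preserve (c1) and (c2); 2 refutes an implication; 3 and 4 refute a box in two moves, first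
    upwards and then to the failing successor; 5 verifies a diamond; 6 separates two truth
    sets.\<close>
  define Q where "Q = (\<lambda>(k, \<phi>, \<psi>) a b c d.
    [(b, ?T \<phi>, d) \<in> acc M \<and> (c, d) \<in> le M,
     (a, d) \<in> le M \<and> (d, ?T \<phi>, c) \<in> acc M,
     (a, d) \<in> le M \<and> sat M \<phi> d \<and> \<not> sat M \<psi> d,
     (a, d) \<in> le M \<and> (\<exists>u. (d, ?T \<phi>, u) \<in> acc M \<and> \<not> sat M \<psi> u),
     (a, ?T \<phi>, d) \<in> acc M \<and> \<not> sat M \<psi> d,
     (a, ?T \<phi>, d) \<in> acc M \<and> sat M \<psi> d,
     sat M \<phi> d \<and> \<not> sat M \<psi> d] ! k)"
  have "countable {w}" "{w} \<subseteq> worlds M" using assms by auto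
  then obtain B where B: "countable B" "{w} \<subseteq> B" "B \<subseteq> worlds M"
    and closed: "\<forall>i. \<forall>a\<in>B. \<forall>b\<in>B. \<forall>c\<in>B. \<forall>d\<in>worlds M. Q i a b c d \<longrightarrow> (\<exists>d\<in>B. Q i a b c d)"
    by (rule countable_closure[where Q = Q])
  have c1: "\<exists>d\<in>B. (b, ?T \<phi>, d) \<in> acc M \<and> (c, d) \<in> le M"
    if "b \<in> B" "c \<in> B" "(b, ?T \<phi>, d) \<in> acc M" "(c, d) \<in> le M" for b c d \<phi>
    using closed[rule_format, of b b c d "(0, \<phi>, \<phi>)"] that le_worlds unfolding Q_def by simp
  have c2: "\<exists>d\<in>B. (a, d) \<in> le M \<and> (d, ?T \<phi>, c) \<in> acc M"
    if "a \<in> B" "c \<in> B" "(a, d) \<in> le M" "(d, ?T \<phi>, c) \<in> acc M" for a c d \<phi>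
    using closed[rule_format, of a a c d "(1, \<phi>, \<phi>)"] that le_worlds unfolding Q_def by simp
  have imp: "\<exists>d\<in>B. (a, d) \<in> le M \<and> sat M \<phi> d \<and> \<not> sat M \<psi> d"
    if "a \<in> B" "(a, d) \<in> le M" "sat M \<phi> d" "\<not> sat M \<psi> d" for a d \<phi> \<psi>
    using closed[rule_format, of a a a d "(2, \<phi>, \<psi>)"] that le_worlds unfolding Q_def by simp
  have box1: "\<exists>d\<in>B. (a, d) \<in> le M \<and> (\<exists>u. (d, ?T \<phi>, u) \<in> acc M \<and> \<not> sat M \<psi> u)"
    if "a \<in> B" "(a, d) \<in> le M" "\<exists>u. (d, ?T \<phi>, u) \<in> acc M \<and> \<not> sat M \<psi> u" for a d \<phi> \<psi>
    using closed[rule_format, of a a a d "(3, \<phi>, \<psi>)"] that le_worlds unfolding Q_def by simp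
  have box2: "\<exists>d\<in>B. (a, ?T \<phi>, d) \<in> acc M \<and> \<not> sat M \<psi> d"
    if "a \<in> B" "(a, ?T \<phi>, d) \<in> acc M" "\<not> sat M \<psi> d" for a d \<phi> \<psi>
    using closed[rule_format, of a a a d "(4, \<phi>, \<psi>)"] that acc_worlds unfolding Q_def by simp
  have dia: "\<exists>d\<in>B. (a, ?T \<phi>, d) \<in> acc M \<and> sat M \<psi> d"
    if "a \<in> B" "(a, ?T \<phi>, d) \<in> acc M" "sat M \<psi> d" for a d \<phi> \<psi>
    using closed[rule_format, of a a a d "(5, \<phi>, \<psi>)"] that acc_worlds unfolding Q_def by simp
  have dist: "\<exists>d\<in>B. sat M \<phi> d \<and> \<not> sat M \<psi> d"
    if "d \<in> worlds M" "sat M \<phi> d" "\<not> sat M \<psi> d" for d \<phi> \<psi>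
    using closed[rule_format, of w w w d "(6, \<phi>, \<psi>)"] that B(2) unfolding Q_def by simp
  have T_eq: "?T \<phi> = ?T \<psi>" if "?T \<phi> \<inter> B = ?T \<psi> \<inter> B" for \<phi> \<psi>
    using that dist B(3) by blast
  obtain e :: "'w \<Rightarrow> 'u" where e: "inj_on e B"
    using B(1) by (rule countable_inj_on)
  have e_eq: "e a = e b \<longleftrightarrow> a = b" if "a \<in> B" "b \<in> B" for a b
    using e that by (auto simp: inj_on_def)
  have e_img: "e a \<in> e ` X \<longleftrightarrow> a \<in> X" if "a \<in> B" "X \<subseteq> B" for a X
    using e that by (auto simp: inj_on_def)
  \<comment> \<open>For an index that is not the trace of a truth set on \<open>B\<close>,
    \<open>acc\<close> is empty, so (c1) and (c2) hold vacuously there.\<close>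
  define N :: "'u chellas" where "N = \<lparr>worlds = e ` B,
    le = {(e a, e b) |a b. a \<in> B \<and> b \<in> B \<and> (a, b) \<in> le M},
    acc = {(e a, e ` (?T \<phi> \<inter> B), e b) |a b \<phi>. a \<in> B \<and> b \<in> B \<and> (a, ?T \<phi>, b) \<in> acc M},
    val = (\<lambda>p. e ` (val M p \<inter> B))\<rparr>"
  have N_le: "(e a, y) \<in> le N \<longleftrightarrow> (\<exists>b\<in>B. y = e b \<and> (a, b) \<in> le M)" if "a \<in> B" for a y
    using that by (auto simp: N_def e_eq)
  have N_acc: "(e a, e ` (?T \<phi> \<inter> B), y) \<in> acc N \<longleftrightarrow> (\<exists>b\<in>B. y = e b \<and> (a, ?T \<phi>, b) \<in> acc M)"
    if "a \<in> B" for a y \<phi>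
  proof -
    have "?T \<phi> = ?T \<psi>" if "e ` (?T \<phi> \<inter> B) = e ` (?T \<psi> \<inter> B)" for \<psi>
      using that inj_on_image_eq_iff[OF e, of "?T \<phi> \<inter> B" "?T \<psi> \<inter> B"] T_eq by auto
    then show ?thesis
      using that by (simp add: N_def) (metis (no_types, lifting) e_eq)
  qed
  have truth: "a \<in> B \<Longrightarrow> sat N \<phi> (e a) \<longleftrightarrow> sat M \<phi> a" for a \<phi>
  proof (induction \<phi> arbitrary: a)
    case (Var p)
    then show ?case by (simp add: N_def e_img)
  next
    case (Impl \<phi> \<psi>)
    have "sat N (Impl \<phi> \<psi>) (e a) \<longleftrightarrow> (\<forall>b\<in>B. (a, b) \<in> le M \<longrightarrow> sat M \<phi> b \<longrightarrow> sat M \<psi> b)"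
      using Impl by (auto simp: N_le)
    also have "\<dots> \<longleftrightarrow> sat M (Impl \<phi> \<psi>) a"
      unfolding sat.simps using imp \<open>a \<in> B\<close> by blast
    finally show ?case .
  next
    case (BoxTo \<phi> \<psi>)
    have T: "truth_set N \<phi> = e ` (?T \<phi> \<inter> B)"
      using BoxTo.IH(1) B(3) by (auto simp: N_def)
    have "sat N (BoxTo \<phi> \<psi>) (e a) \<longleftrightarrow> (\<forall>b\<in>B. (a, b) \<in> le M \<longrightarrow>
      (\<forall>u. (e b, e ` (?T \<phi> \<inter> B), u) \<in> acc N \<longrightarrow> sat N \<psi> u))"
      unfolding sat.simps T N_le[OF \<open>a \<in> B\<close>] by blast
    also have "\<dots> \<longleftrightarrow>
      (\<forall>b\<in>B. (a, b) \<in> le M \<longrightarrow> (\<forall>c\<in>B. (b, ?T \<phi>, c) \<in> acc M \<longrightarrow> sat M \<psi> c))"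
      by (intro ball_cong refl imp_cong) (auto simp: N_acc BoxTo.IH(2))
    also have "\<dots> \<longleftrightarrow> sat M (BoxTo \<phi> \<psi>) a" (is "?lhs \<longleftrightarrow> ?rhs")
    proof
      assume *: ?lhs
      show ?rhs
        unfolding sat.simps
      proof (intro allI impI; rule ccontr)
        \<comment> \<open>Neither \<open>v\<close> nor \<open>u\<close> need lie in
          \<open>B\<close>. The upper world is replaced first, keeping only that some successor of
          it fails; then that successor is replaced.\<close>
        fix v u assume "(a, v) \<in> le M" "(v, ?T \<phi>, u) \<in> acc M" "\<not> sat M \<psi> u"
        then obtain b u' where "b \<in> B" "(a, b) \<in> le M" "(b, ?T \<phi>, u') \<in> acc M" "\<not> sat M \<psi> u'"
          using box1[OF \<open>a \<in> B\<close>] by blast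
        then show False using * box2 by blast
      qed
    qed (simp only: sat.simps, blast)
    finally show ?case .
  next
    case (DiaTo \<phi> \<psi>)
    have T: "truth_set N \<phi> = e ` (?T \<phi> \<inter> B)"
      using DiaTo.IH(1) B(3) by (auto simp: N_def)
    have "sat N (DiaTo \<phi> \<psi>) (e a) \<longleftrightarrow> (\<exists>c\<in>B. (a, ?T \<phi>, c) \<in> acc M \<and> sat M \<psi> c)"
      unfolding sat.simps T N_acc[OF \<open>a \<in> B\<close>] using DiaTo.IH(2) by auto
    also have "\<dots> \<longleftrightarrow> sat M (DiaTo \<phi> \<psi>) a"
      unfolding sat.simps using dia[OF \<open>a \<in> B\<close>] by blast
    finally show ?case .
  qed auto
  have "chellas_model N"
    unfolding chellas_model_def
  proof (intro conjI allI impI; (elim conjE)?)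
    show "worlds N \<noteq> {}" using B by (auto simp: N_def)
    show "preorder_on (worlds N) (le N)"
      unfolding preorder_on_def
    proof (intro conjI)
      show "trans (le N)"
      proof (rule transI)
        fix x y z assume "(x, y) \<in> le N" "(y, z) \<in> le N"
        then obtain a b c where "x = e a" "z = e c" "a \<in> B" "c \<in> B" "(a, b) \<in> le M" "(b, c) \<in> le M"
          by (auto simp: N_def e_eq)
        then show "(x, z) \<in> le N"
          using le_trans N_le by blast
      qed
    qed (use B(3) in \<open>auto simp: N_def refl_on_def intro: le_refl\<close>)
    show "acc N \<subseteq> worlds N \<times> Pow (worlds N) \<times> worlds N" by (auto simp: N_def)
    show "val N p \<subseteq> worlds N" for p by (auto simp: N_def)
    show "y \<in> val N p" if "x \<in> val N p" "(x, y) \<in> le N" for p x y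
      using that by (auto simp: N_def e_eq intro!: imageI intro: val_mono)
    show "\<exists>v'. (x', X, v') \<in> acc N \<and> (v, v') \<in> le N"
      if le: "(x, x') \<in> le N" and acc: "(x, X, v) \<in> acc N" for X x x' v
    proof -
      obtain a b \<phi> where ab: "x = e a" "v = e b" "X = e ` (?T \<phi> \<inter> B)" "a \<in> B" "b \<in> B"
        "(a, ?T \<phi>, b) \<in> acc M"
        using acc by (auto simp: N_def)
      obtain a' where a': "x' = e a'" "a' \<in> B" "(a, a') \<in> le M"
        using le ab by (auto simp: N_le)
      obtain b' where "(a', ?T \<phi>, b') \<in> acc M" "(b, b') \<in> le M"
        using a'(3) ab(6) by (rule acc_up)
      then show ?thesis
        using c1[OF a'(2) ab(5)] N_acc[OF a'(2)] N_le[OF ab(5)] a'(1) ab(2,3) by blast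
    qed
    show "\<exists>x'. (x, x') \<in> le N \<and> (x', X, v') \<in> acc N"
      if acc: "(x, X, v) \<in> acc N" and le: "(v, v') \<in> le N" for X x v v'
    proof -
      obtain a b \<phi> where ab: "x = e a" "v = e b" "X = e ` (?T \<phi> \<inter> B)" "a \<in> B" "b \<in> B"
        "(a, ?T \<phi>, b) \<in> acc M"
        using acc by (auto simp: N_def)
      obtain b' where b': "v' = e b'" "b' \<in> B" "(b, b') \<in> le M"
        using le ab by (auto simp: N_le)
      obtain a' where "(a, a') \<in> le M" "(a', ?T \<phi>, b') \<in> acc M"
        using ab(6) b'(3) by (rule acc_down)
      then show ?thesis
        using c2[OF ab(4) b'(2)] N_acc N_le[OF ab(4)] b'(1,2) ab(1,3) by blast
    qed
  qed
  moreover have "e w \<in> worlds N" using B by (auto simp: N_def)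
  moreover have "\<forall>\<phi>. sat N \<phi> (e w) \<longleftrightarrow> sat M \<phi> w"
    using truth B(2) by simp
  ultimately show ?thesis by (rule that)
qed

end

section \<open>Kripke sheaves\<close>

locale sheaf =
  fixes K :: "('v, 'a) sheaf"
  assumes sheaf: "kripke_sheaf K"
begin

lemma ord_nodes: "(v, u) \<in> ord K \<Longrightarrow> v \<in> nodes K \<and> u \<in> nodes K"
  using sheaf by (auto simp: kripke_sheaf_def preorder_on_def)

lemma ord_refl: "v \<in> nodes K \<Longrightarrow> (v, v) \<in> ord K"
  using sheaf by (auto simp: kripke_sheaf_def preorder_on_def refl_on_def)

lemma ord_trans:
  assumes "(v, u) \<in> ord K" "(u, t) \<in> ord K"
  shows "(v, t) \<in> ord K"
proof -
  have "trans (ord K)"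
    using sheaf unfolding kripke_sheaf_def preorder_on_def by (elim conjE)
  then show ?thesis using assms by (rule transD)
qed

lemma homomorphism_hom: "(v, u) \<in> ord K \<Longrightarrow> homomorphism (str K v) (str K u) (hom K v u)"
  using sheaf by (simp add: kripke_sheaf_def)

lemma hom_dom: "(v, u) \<in> ord K \<Longrightarrow> a \<in> dom (str K v) \<Longrightarrow> hom K v u a \<in> dom (str K u)"
  and hom_predI: "(v, u) \<in> ord K \<Longrightarrow> a \<in> predI (str K v) p \<Longrightarrow> hom K v u a \<in> predI (str K u) p"
  and hom_objI: "(v, u) \<in> ord K \<Longrightarrow> a \<in> objI (str K v) \<Longrightarrow> hom K v u a \<in> objI (str K u)"
  and hom_setI: "(v, u) \<in> ord K \<Longrightarrow> a \<in> setI (str K v) \<Longrightarrow> hom K v u a \<in> setI (str K u)"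
  and hom_elemI: "(v, u) \<in> ord K \<Longrightarrow> (a, b) \<in> elemI (str K v) \<Longrightarrow>
    (hom K v u a, hom K v u b) \<in> elemI (str K u)"
  and hom_relI: "(v, u) \<in> ord K \<Longrightarrow> (a, b, c) \<in> relI (str K v) \<Longrightarrow>
    (hom K v u a, hom K v u b, hom K v u c) \<in> relI (str K u)"
  by (use homomorphism_hom[of v u] in \<open>auto simp: homomorphism_def\<close>)

lemma hom_id: "v \<in> nodes K \<Longrightarrow> a \<in> dom (str K v) \<Longrightarrow> hom K v v a = a"
  using sheaf by (simp add: kripke_sheaf_def)

lemma hom_comp: "(v, u) \<in> ord K \<Longrightarrow> (u, t) \<in> ord K \<Longrightarrow> a \<in> dom (str K v) \<Longrightarrow>
    hom K u t (hom K v u a) = hom K v t a"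
  using sheaf by (simp add: kripke_sheaf_def)

lemma classical: "v \<in> nodes K \<Longrightarrow> classical_structure (str K v)"
  using sheaf by (simp add: kripke_sheaf_def)

lemma objI_dom: "v \<in> nodes K \<Longrightarrow> a \<in> objI (str K v) \<Longrightarrow> a \<in> dom (str K v)"
  and setI_dom: "v \<in> nodes K \<Longrightarrow> a \<in> setI (str K v) \<Longrightarrow> a \<in> dom (str K v)"
  and predI_dom: "v \<in> nodes K \<Longrightarrow> a \<in> predI (str K v) p \<Longrightarrow> a \<in> dom (str K v)"
  and relI_dom: "v \<in> nodes K \<Longrightarrow> (a, b, c) \<in> relI (str K v) \<Longrightarrow>
    a \<in> dom (str K v) \<and> b \<in> dom (str K v) \<and> c \<in> dom (str K v)"
  using classical[of v] by (auto simp: classical_structure_def)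

text \<open>The identity and composition laws of \<open>hom\<close> hold on domains only, so
  rewriting transported assignments needs values in the right domain.\<close>

definition asg :: "'v \<Rightarrow> (ivar \<Rightarrow> 'a) \<Rightarrow> bool" where
  "asg v g \<longleftrightarrow> (\<forall>x. g x \<in> dom (str K v))"

lemma asg_upd: "asg v g \<Longrightarrow> a \<in> dom (str K v) \<Longrightarrow> asg v (g(x := a))"
  by (simp add: asg_def)

lemma asg_hom: "asg v g \<Longrightarrow> (v, u) \<in> ord K \<Longrightarrow> asg u (hom K v u \<circ> g)"
  by (simp add: asg_def hom_dom)

lemma hom_comp_asg:
  "asg v g \<Longrightarrow> (v, u) \<in> ord K \<Longrightarrow> (u, t) \<in> ord K \<Longrightarrow> hom K u t \<circ> (hom K v u \<circ> g) = hom K v t \<circ> g"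
  by (simp add: asg_def hom_comp fun_eq_iff)

lemma hom_id_asg: "asg v g \<Longrightarrow> v \<in> nodes K \<Longrightarrow> hom K v v \<circ> g = g"
  by (simp add: asg_def hom_id fun_eq_iff)

lemma hom_upd: "hom K u t \<circ> g(x := a) = (hom K u t \<circ> g)(x := hom K u t a)"
  by (simp add: fun_eq_iff)

section \<open>Persistence and quantified implications\<close>

text \<open>Atoms persist because transitions are homomorphisms, an existential by moving its
  witness, and implication and the universal quantifier because two transitions compose to
  one.\<close>

lemma persistence:
  "fosat K \<phi> v g \<Longrightarrow> asg v g \<Longrightarrow> (v, u) \<in> ord K \<Longrightarrow> fosat K \<phi> u (hom K v u \<circ> g)"
proof (induction \<phi> arbitrary: v g)
  case (FAnd \<phi> \<psi>)
  then show ?case unfolding fosat.simps by blast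
next
  case (FOr \<phi> \<psi>)
  then show ?case unfolding fosat.simps by blast
next
  case (FImp \<phi> \<psi>)
  show ?case
    unfolding fosat.simps
  proof (intro allI impI)
    fix t assume t: "(u, t) \<in> ord K"
    show "fosat K \<psi> t (hom K u t \<circ> (hom K v u \<circ> g))"
      if "fosat K \<phi> t (hom K u t \<circ> (hom K v u \<circ> g))"
      using FImp.prems(1) that ord_trans[OF FImp.prems(3) t]
      unfolding hom_comp_asg[OF FImp.prems(2,3) t] fosat.simps by blast
  qed
next
  case (FAll x \<phi>)
  show ?case
    unfolding fosat.simps
  proof (intro allI impI)
    fix t assume t: "(u, t) \<in> ord K"
    show "\<forall>a\<in>dom (str K t). fosat K \<phi> t ((hom K u t \<circ> (hom K v u \<circ> g))(x := a))"
      using FAll.prems(1) ord_trans[OF FAll.prems(3) t]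
      unfolding hom_comp_asg[OF FAll.prems(2,3) t] fosat.simps by blast
  qed
next
  case (FEx x \<phi>)
  then obtain a where a: "a \<in> dom (str K v)" "fosat K \<phi> v (g(x := a))" by auto
  then have "fosat K \<phi> u (hom K v u \<circ> g(x := a))"
    using FEx asg_upd by blast
  then show ?case
    unfolding fosat.simps hom_upd using hom_dom[OF FEx.prems(3) a(1)] by blast
qed (auto intro: hom_predI hom_objI hom_setI hom_elemI hom_relI)

lemma FAll_D:
  assumes "fosat K (FAll x \<phi>) v g" "v \<in> nodes K" "asg v g" "a \<in> dom (str K v)"
  shows "fosat K \<phi> v (g(x := a))"
  using assms ord_refl[of v] hom_id_asg[of v g] by (metis fosat.simps(12))

lemma FImp_D:
  assumes "fosat K (\<phi> \<^bold>\<longrightarrow> \<psi>) v g" "v \<in> nodes K" "asg v g" "fosat K \<phi> v g"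
  shows "fosat K \<psi> v g"
  using assms ord_refl[of v] hom_id_asg[of v g] by (metis fosat.simps(11))

lemma FIff_D:
  assumes "fosat K (\<phi> \<^bold>\<longleftrightarrow> \<psi>) v g" "v \<in> nodes K" "asg v g"
  shows "fosat K \<phi> v g \<longleftrightarrow> fosat K \<psi> v g"
  using assms FImp_D[OF _ assms(2,3)] unfolding fosat.simps(9) by blast

text \<open>An implication below a quantifier climbs to a second node. The individual carried there
  is again one over which the quantifier ranges, so the two climbs collapse to one.\<close>

lemma FAll_FImp_iff:
  assumes "asg v g"
  shows "fosat K (FAll x (\<phi> \<^bold>\<longrightarrow> \<psi>)) v g \<longleftrightarrow> (\<forall>u. (v, u) \<in> ord K \<longrightarrow> (\<forall>a\<in>dom (str K u).
    fosat K \<phi> u ((hom K v u \<circ> g)(x := a)) \<longrightarrow> fosat K \<psi> u ((hom K v u \<circ> g)(x := a))))"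
  (is "?l \<longleftrightarrow> ?r")
proof
  assume ?l
  show ?r
  proof (intro allI ballI impI)
    fix u a assume u: "(v, u) \<in> ord K" "a \<in> dom (str K u)"
      and sat: "fosat K \<phi> u ((hom K v u \<circ> g)(x := a))"
    have "fosat K (\<phi> \<^bold>\<longrightarrow> \<psi>) u ((hom K v u \<circ> g)(x := a))"
      using \<open>?l\<close> u by simp
    moreover have "u \<in> nodes K" "asg u ((hom K v u \<circ> g)(x := a))"
      using u ord_nodes asg_upd asg_hom assms by blast+
    ultimately show "fosat K \<psi> u ((hom K v u \<circ> g)(x := a))" using sat by (rule FImp_D)
  qed
next
  assume r: ?r
  show ?l
    unfolding fosat.simps
  proof (intro allI ballI impI)
    fix u a t assume u: "(v, u) \<in> ord K" "a \<in> dom (str K u)" "(u, t) \<in> ord K"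
      and sat: "fosat K \<phi> t (hom K u t \<circ> (hom K v u \<circ> g)(x := a))"
    have "hom K u t \<circ> (hom K v u \<circ> g)(x := a) = (hom K v t \<circ> g)(x := hom K u t a)"
      using hom_comp_asg[OF assms u(1,3)] by (simp add: hom_upd)
    then show "fosat K \<psi> t (hom K u t \<circ> (hom K v u \<circ> g)(x := a))"
      using r sat u hom_dom ord_trans by auto
  qed
qed

text \<open>The same collapse, with objects stable under transitions. Extensionality, the axioms for
  the connectives and conditionals, and the defining clauses in \<open>ST\<close> all contain a
  formula of this shape.\<close>

lemma FAllO_FIff_iff:
  assumes g: "asg v g"
  shows "fosat K (FAllO x (\<phi> \<^bold>\<longleftrightarrow> \<psi>)) v g \<longleftrightarrow> (\<forall>u. (v, u) \<in> ord K \<longrightarrow> (\<forall>a\<in>objI (str K u).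
    fosat K \<phi> u ((hom K v u \<circ> g)(x := a)) \<longleftrightarrow> fosat K \<psi> u ((hom K v u \<circ> g)(x := a))))"
  (is "?l \<longleftrightarrow> ?r")
proof
  assume l: ?l
  show ?r
  proof (intro allI ballI impI)
    fix u a assume u: "(v, u) \<in> ord K" "a \<in> objI (str K u)"
    have nodes: "u \<in> nodes K" "a \<in> dom (str K u)"
      using u ord_nodes objI_dom by blast+
    have asg: "asg u ((hom K v u \<circ> g)(x := a))"
      using u nodes asg_upd asg_hom assms by blast
    have "fosat K (\<phi> \<^bold>\<longleftrightarrow> \<psi>) u ((hom K v u \<circ> g)(x := a))"
      using l[unfolded FAll_FImp_iff[OF g]] u nodes by simp
    then show "fosat K \<phi> u ((hom K v u \<circ> g)(x := a)) \<longleftrightarrow> fosat K \<psi> u ((hom K v u \<circ> g)(x := a))"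
      using nodes(1) asg by (rule FIff_D)
  qed
next
  assume r: ?r
  show ?l
    unfolding FAll_FImp_iff[OF g]
  proof (intro allI ballI impI)
    fix u a assume u: "(v, u) \<in> ord K" "a \<in> dom (str K u)"
      and obj: "fosat K (ObjA x) u ((hom K v u \<circ> g)(x := a))"
    have "hom K u t \<circ> (hom K v u \<circ> g)(x := a) = (hom K v t \<circ> g)(x := hom K u t a)"
      if "(u, t) \<in> ord K" for t
      using hom_comp_asg[OF assms u(1) that] by (simp add: hom_upd)
    then show "fosat K (\<phi> \<^bold>\<longleftrightarrow> \<psi>) u ((hom K v u \<circ> g)(x := a))"
      using r u(1) obj hom_objI ord_trans by auto
  qed
qed

end

section \<open>From Kripke sheaves to Chellas models\<close>

text \<open>The theory is given at one node under one assignment. Persistence spreads it to the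
  nodes above \<open>r\<close>, and the Chellas model is built over these alone.\<close>

locale Th_sheaf = sheaf K for K :: "('v, 'a) sheaf" +
  fixes r :: 'v and f :: "ivar \<Rightarrow> 'a"
  assumes root: "r \<in> nodes K"
    and asg_f: "asg r f"
    and Th: "\<phi> \<in> Th \<Longrightarrow> fosat K \<phi> r f"
begin

abbreviation cone :: "'v set" where
  "cone \<equiv> {v. (r, v) \<in> ord K}"

lemma cone_nodes: "v \<in> cone \<Longrightarrow> v \<in> nodes K"
  and cone_up: "v \<in> cone \<Longrightarrow> (v, u) \<in> ord K \<Longrightarrow> u \<in> cone"
  and root_cone: "r \<in> cone"
  using ord_nodes ord_trans ord_refl root by auto

section \<open>Consequences of the axioms above the root\<close>

text \<open>The axioms bind all their variables, so an unspecified assignment is enough: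
  instantiating the quantifiers overwrites the values of interest.\<close>

lemma Th_cone:
  assumes "\<phi> \<in> Th" "v \<in> cone"
  obtains g where "asg v g" "fosat K \<phi> v g"
  using assms Th asg_f asg_hom persistence by blast

text \<open>Set elements decide membership for objects only, so a successor along \<open>R\<close>
  must be known to be an object before its membership can be read as truth.\<close>

lemma relI_sorts:
  assumes v: "v \<in> cone" and R: "(a, s, b) \<in> relI (str K v)"
  shows "s \<in> setI (str K v)" "b \<in> objI (str K v)"
proof -
  have n: "v \<in> nodes K" using v cone_nodes by blast
  have dom: "a \<in> dom (str K v)" "s \<in> dom (str K v)" "b \<in> dom (str K v)"
    using R n relI_dom by blast+
  have "FAll 0 (FAll 1 (FAll 2 (RelA 0 1 2 \<^bold>\<longrightarrow> (ObjA 0 \<^bold>\<and> SetA 1 \<^bold>\<and> ObjA 2)))) \<in> Th"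
    unfolding Th_def Let_def by blast
  then obtain g where g: "asg v g"
    "fosat K (FAll 0 (FAll 1 (FAll 2 (RelA 0 1 2 \<^bold>\<longrightarrow> (ObjA 0 \<^bold>\<and> SetA 1 \<^bold>\<and> ObjA 2))))) v g"
    using Th_cone v by blast
  let ?g = "g(0 := a, 1 := s, 2 := b)"
  have "fosat K (RelA 0 1 2 \<^bold>\<longrightarrow> (ObjA 0 \<^bold>\<and> SetA 1 \<^bold>\<and> ObjA 2)) v ?g"
    using g dom n by (intro FAll_D asg_upd)
  then have "fosat K (ObjA 0 \<^bold>\<and> SetA 1 \<^bold>\<and> ObjA 2) v ?g"
    by (rule FImp_D) (use n g dom R in \<open>simp_all add: asg_upd\<close>)
  then show "s \<in> setI (str K v)" "b \<in> objI (str K v)" by auto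
qed

text \<open>The premise of the axiom is an intuitionistic equivalence; agreement is therefore
  demanded at every node above \<open>v\<close> and not just at \<open>v\<close>.\<close>

lemma extensional:
  assumes v: "v \<in> cone" and s: "s \<in> setI (str K v)" "t \<in> setI (str K v)"
    and eq: "\<And>u a. (v, u) \<in> ord K \<Longrightarrow> a \<in> objI (str K u) \<Longrightarrow>
      (a, hom K v u s) \<in> elemI (str K u) \<longleftrightarrow> (a, hom K v u t) \<in> elemI (str K u)"
  shows "s = t"
proof -
  have n: "v \<in> nodes K" using v cone_nodes by blast
  have dom: "s \<in> dom (str K v)" "t \<in> dom (str K v)"
    using s n setI_dom by blast+
  let ?eq = "FAllO 2 (ElemA 2 0 \<^bold>\<longleftrightarrow> ElemA 2 1)"
  have "FAll 0 (FAll 1 ((SetA 0 \<^bold>\<and> SetA 1 \<^bold>\<and> ?eq) \<^bold>\<longrightarrow> 0 \<^bold>\<equiv> 1)) \<in> Th"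
    unfolding Th_def Let_def by blast
  then obtain g where g: "asg v g"
    "fosat K (FAll 0 (FAll 1 ((SetA 0 \<^bold>\<and> SetA 1 \<^bold>\<and> ?eq) \<^bold>\<longrightarrow> 0 \<^bold>\<equiv> 1))) v g"
    using Th_cone v by blast
  let ?g = "g(0 := s, 1 := t)"
  have asg: "asg v ?g" using g dom by (intro asg_upd)
  have "fosat K ((SetA 0 \<^bold>\<and> SetA 1 \<^bold>\<and> ?eq) \<^bold>\<longrightarrow> 0 \<^bold>\<equiv> 1) v ?g"
    using g dom n by (intro FAll_D asg_upd)
  moreover have "fosat K ?eq v ?g"
    unfolding FAllO_FIff_iff[OF asg] using eq by simp
  then have "fosat K (SetA 0 \<^bold>\<and> SetA 1 \<^bold>\<and> ?eq) v ?g"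
    using s by (simp del: fosat.simps(11,12))
  ultimately have "fosat K (0 \<^bold>\<equiv> 1) v ?g"
    using FImp_D n asg by blast
  then show ?thesis by simp
qed

text \<open>The axioms for the three connectives and the two conditionals share this form and are
  unpacked together. Variables 0 and 1 hold the given sets and 3 the tested object.\<close>

lemma binary_comprehension:
  assumes "FAll 0 (FAll 1 ((SetA 0 \<^bold>\<and> SetA 1) \<^bold>\<longrightarrow>
      FEx 2 (SetA 2 \<^bold>\<and> FAllO 3 (ElemA 3 2 \<^bold>\<longleftrightarrow> \<chi>)))) \<in> Th" (is "?ax \<in> Th")
    and v: "v \<in> cone" and s: "s \<in> setI (str K v)" "t \<in> setI (str K v)"
  obtains g z where "asg v g" "g 0 = s" "g 1 = t" "z \<in> setI (str K v)"
    "\<And>u a. (v, u) \<in> ord K \<Longrightarrow> a \<in> objI (str K u) \<Longrightarrow>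
      (a, hom K v u z) \<in> elemI (str K u) \<longleftrightarrow> fosat K \<chi> u ((hom K v u \<circ> g)(3 := a))"
proof -
  have n: "v \<in> nodes K" using v cone_nodes by blast
  have dom: "s \<in> dom (str K v)" "t \<in> dom (str K v)"
    using s n setI_dom by blast+
  obtain g where g: "asg v g" "fosat K ?ax v g"
    using assms(1) Th_cone v by blast
  let ?g = "g(0 := s, 1 := t)"
  let ?A = "FAllO 3 (ElemA 3 2 \<^bold>\<longleftrightarrow> \<chi>)"
  have asg: "asg v ?g" using g dom by (intro asg_upd)
  have "fosat K ((SetA 0 \<^bold>\<and> SetA 1) \<^bold>\<longrightarrow> FEx 2 (SetA 2 \<^bold>\<and> ?A)) v ?g"
    using g dom n by (intro FAll_D asg_upd)
  then have "fosat K (FEx 2 (SetA 2 \<^bold>\<and> ?A)) v ?g"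
    by (rule FImp_D) (use n asg s in simp_all)
  then obtain z where z: "z \<in> dom (str K v)" "z \<in> setI (str K v)" "fosat K ?A v (?g(2 := z))"
    unfolding fosat.simps(5-6,9,13) by auto
  have asg': "asg v (?g(2 := z))" using asg z(1) by (rule asg_upd)
  show ?thesis
  proof (rule that[OF asg' _ _ z(2)])
    fix u a assume "(v, u) \<in> ord K" "a \<in> objI (str K u)"
    then show "(a, hom K v u z) \<in> elemI (str K u) \<longleftrightarrow>
        fosat K \<chi> u ((hom K v u \<circ> ?g(2 := z))(3 := a))"
      using z(3)[unfolded FAllO_FIff_iff[OF asg']] by simp
  qed simp_all
qed


section \<open>The Chellas model on pairs\<close>

definition pairs :: "('v \<times> 'a) set" where
  "pairs = {(v, a). v \<in> cone \<and> a \<in> dom (str K v)}"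

text \<open>
  A set element \<open>s\<close> lives over \<open>v\<close> only, so it can determine \<open>X\<close> only on the objects over the
  nodes above \<open>v\<close>.
\<close>

definition represents :: "'v \<Rightarrow> 'a \<Rightarrow> ('v \<times> 'a) set \<Rightarrow> bool" where
  "represents v s X \<longleftrightarrow> s \<in> setI (str K v) \<and> (\<forall>u. (v, u) \<in> ord K \<longrightarrow>
     (\<forall>a\<in>objI (str K u). (a, hom K v u s) \<in> elemI (str K u) \<longleftrightarrow> (u, a) \<in> X))"

text \<open>
  All individuals serve as worlds, since the free variable of a translation may denote a set
  element; such worlds have no \<open>acc\<close>-successors and force no variable.
\<close>

definition pair_model :: "('v \<times> 'a) chellas" where
  "pair_model = \<lparr>worlds = pairs,
     le = {((v, a), (u, b)). (v, a) \<in> pairs \<and> (v, u) \<in> ord K \<and> b = hom K v u a},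
     acc = {((v, a), X, (u, b)). u = v \<and> v \<in> cone \<and> X \<subseteq> pairs \<and>
       (\<exists>s. (a, s, b) \<in> relI (str K v) \<and> represents v s X)},
     val = (\<lambda>p. {(v, a). v \<in> cone \<and> a \<in> predI (str K v) p})\<rparr>"

lemma pair_model_simps:
  "worlds pair_model = pairs"
  "((v, a), y) \<in> le pair_model \<longleftrightarrow> (v, a) \<in> pairs \<and> (\<exists>u. (v, u) \<in> ord K \<and> y = (u, hom K v u a))"
  "((v, a), X, y) \<in> acc pair_model \<longleftrightarrow> v \<in> cone \<and> X \<subseteq> pairs \<and>
     (\<exists>s b. y = (v, b) \<and> (a, s, b) \<in> relI (str K v) \<and> represents v s X)"
  "(v, a) \<in> val pair_model p \<longleftrightarrow> v \<in> cone \<and> a \<in> predI (str K v) p"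
  by (auto simp: pair_model_def)

lemma pairsD: "(v, a) \<in> pairs \<Longrightarrow> v \<in> cone \<and> v \<in> nodes K \<and> a \<in> dom (str K v)"
  using cone_nodes by (auto simp: pairs_def)

lemma pairs_up: "(v, a) \<in> pairs \<Longrightarrow> (v, u) \<in> ord K \<Longrightarrow> (u, hom K v u a) \<in> pairs"
  using cone_up hom_dom by (auto simp: pairs_def)

lemma represents_up:
  assumes "v \<in> cone" "represents v s X" "(v, u) \<in> ord K"
  shows "represents u (hom K v u s) X"
  unfolding represents_def
proof (intro conjI allI impI ballI)
  have s: "s \<in> setI (str K v)" using assms(2) by (simp add: represents_def)
  then show "hom K v u s \<in> setI (str K u)" using assms(3) by (simp add: hom_setI)
  fix t a assume t: "(u, t) \<in> ord K" "a \<in> objI (str K t)"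
  have "hom K u t (hom K v u s) = hom K v t s"
    using hom_comp[OF assms(3) t(1)] setI_dom[OF cone_nodes[OF assms(1)] s] by simp
  then show "(a, hom K u t (hom K v u s)) \<in> elemI (str K t) \<longleftrightarrow> (t, a) \<in> X"
    using assms(2) t ord_trans[OF assms(3) t(1)] by (simp add: represents_def)
qed

text \<open>Uniqueness reduces the existential over \<open>s\<close> in \<open>acc\<close> to one
  known element: the successors for a truth set are exactly the \<open>R\<close>-successors along
  its representative.\<close>

lemma represents_unique: "v \<in> cone \<Longrightarrow> represents v s X \<Longrightarrow> represents v t X \<Longrightarrow> s = t"
  by (rule extensional) (auto simp: represents_def)

text \<open>A pair above another one arises by moving along a homomorphism to some node
  \<open>u\<close>. Moving the whole edge to \<open>u\<close> answers (c1) and (c2) alike, since the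
  transported set element still represents \<open>X\<close>.\<close>

lemma chellas_pair_model: "chellas_model pair_model"
  unfolding chellas_model_def
proof (intro conjI allI impI; (elim conjE)?)
  show "worlds pair_model \<noteq> {}"
    using root_cone asg_f by (auto simp: pair_model_simps pairs_def asg_def)
  show "preorder_on (worlds pair_model) (le pair_model)"
    unfolding preorder_on_def
  proof (intro conjI)
    show "le pair_model \<subseteq> worlds pair_model \<times> worlds pair_model"
      by (auto simp: pair_model_simps pairs_up)
    show "refl_on (worlds pair_model) (le pair_model)"
    proof (rule refl_onI)
      fix x assume "x \<in> worlds pair_model"
      then obtain v a where "x = (v, a)" "(v, a) \<in> pairs"
        by (cases x) (simp add: pair_model_simps)
      then show "(x, x) \<in> le pair_model"
        using pairsD ord_refl[of v] hom_id[of v a] by (auto simp: pair_model_simps)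
    qed
    show "trans (le pair_model)"
    proof (rule transI)
      fix x y z assume xyz: "(x, y) \<in> le pair_model" "(y, z) \<in> le pair_model"
      obtain v a where x: "x = (v, a)" by fastforce
      obtain u where u: "(v, a) \<in> pairs" "(v, u) \<in> ord K" "y = (u, hom K v u a)"
        using xyz(1) x by (auto simp: pair_model_simps)
      obtain t where t: "(u, t) \<in> ord K" "z = (t, hom K u t (hom K v u a))"
        using xyz(2) u by (auto simp: pair_model_simps)
      have "z = (t, hom K v t a)"
        using t hom_comp[OF u(2) t(1)] pairsD[OF u(1)] by simp
      then show "(x, z) \<in> le pair_model"
        using x u(1) ord_trans[OF u(2) t(1)] by (auto simp: pair_model_simps)
    qed
  qed
  show "acc pair_model \<subseteq> worlds pair_model \<times> Pow (worlds pair_model) \<times> worlds pair_model"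
  proof
    fix x assume "x \<in> acc pair_model"
    then obtain v a X b s where "x = ((v, a), X, (v, b))" "v \<in> cone" "X \<subseteq> pairs"
      "(a, s, b) \<in> relI (str K v)"
      unfolding pair_model_def by auto
    then show "x \<in> worlds pair_model \<times> Pow (worlds pair_model) \<times> worlds pair_model"
      using relI_dom[OF cone_nodes, of v a s b] by (simp add: pair_model_simps pairs_def)
  qed
  show "val pair_model p \<subseteq> worlds pair_model" for p
    by (auto simp: pair_model_def pairs_def predI_dom dest: ord_nodes)
  show "y \<in> val pair_model p" if "x \<in> val pair_model p" "(x, y) \<in> le pair_model" for p x y
    using that cone_up hom_predI by (cases x) (auto simp: pair_model_simps)
  show "\<exists>y'. (x', X, y') \<in> acc pair_model \<and> (y, y') \<in> le pair_model"
    if le: "(x, x') \<in> le pair_model" and acc: "(x, X, y) \<in> acc pair_model" for X x x' y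
  proof -
    obtain v a where x: "x = (v, a)" by fastforce
    obtain u where u: "(v, a) \<in> pairs" "(v, u) \<in> ord K" "x' = (u, hom K v u a)"
      using le x by (auto simp: pair_model_simps)
    obtain s b where s: "v \<in> cone" "X \<subseteq> pairs" "y = (v, b)" "(a, s, b) \<in> relI (str K v)"
      "represents v s X"
      using acc x by (auto simp: pair_model_simps)
    have "b \<in> dom (str K v)" using relI_dom s cone_nodes by blast
    then have "(y, (u, hom K v u b)) \<in> le pair_model"
      using s u by (auto simp: pair_model_simps pairs_def)
    moreover have "(x', X, (u, hom K v u b)) \<in> acc pair_model"
      using s u cone_up represents_up hom_relI[OF u(2) s(4)] by (auto simp: pair_model_simps)
    ultimately show ?thesis by blast
  qed
  show "\<exists>x'. (x, x') \<in> le pair_model \<and> (x', X, y') \<in> acc pair_model"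
    if acc: "(x, X, y) \<in> acc pair_model" and le: "(y, y') \<in> le pair_model" for X x y y'
  proof -
    obtain v a where x: "x = (v, a)" by fastforce
    obtain s b where s: "v \<in> cone" "X \<subseteq> pairs" "y = (v, b)" "(a, s, b) \<in> relI (str K v)"
      "represents v s X"
      using acc x by (auto simp: pair_model_simps)
    obtain u where u: "(v, u) \<in> ord K" "y' = (u, hom K v u b)"
      using le s by (auto simp: pair_model_simps)
    have "a \<in> dom (str K v)" using relI_dom s cone_nodes by blast
    then have "(x, (u, hom K v u a)) \<in> le pair_model"
      using s u x by (auto simp: pair_model_simps pairs_def)
    moreover have "((u, hom K v u a), X, y') \<in> acc pair_model"
      using s u cone_up represents_up hom_relI[OF u(1) s(4)] by (auto simp: pair_model_simps)
    ultimately show ?thesis by blast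
  qed
qed

lemma sat_Impl_pair:
  assumes "(v, a) \<in> pairs"
  shows "sat pair_model (Impl \<phi> \<psi>) (v, a) \<longleftrightarrow> (\<forall>u. (v, u) \<in> ord K \<longrightarrow>
    sat pair_model \<phi> (u, hom K v u a) \<longrightarrow> sat pair_model \<psi> (u, hom K v u a))"
  using assms by (auto simp: pair_model_simps)

lemma sat_BoxTo_pair:
  assumes "(v, a) \<in> pairs" and s: "represents v s (truth_set pair_model \<phi>)"
  shows "sat pair_model (BoxTo \<phi> \<psi>) (v, a) \<longleftrightarrow> (\<forall>u b. (v, u) \<in> ord K \<longrightarrow>
    (hom K v u a, hom K v u s, b) \<in> relI (str K u) \<longrightarrow> sat pair_model \<psi> (u, b))"
proof -
  let ?T = "truth_set pair_model \<phi>"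
  have v: "v \<in> cone" using assms(1) pairsD by blast
  have acc: "((u, hom K v u a), ?T, y) \<in> acc pair_model \<longleftrightarrow>
      (\<exists>b. y = (u, b) \<and> (hom K v u a, hom K v u s, b) \<in> relI (str K u))" if "(v, u) \<in> ord K" for u y
    using represents_up[OF v s that] represents_unique[OF cone_up[OF v that]] cone_up[OF v that]
    by (auto simp: pair_model_simps)
  have "sat pair_model (BoxTo \<phi> \<psi>) (v, a) \<longleftrightarrow> (\<forall>u. (v, u) \<in> ord K \<longrightarrow>
      (\<forall>y. ((u, hom K v u a), ?T, y) \<in> acc pair_model \<longrightarrow> sat pair_model \<psi> y))"
    unfolding sat.simps pair_model_simps(2) using assms(1) by auto
  then show ?thesis by (auto simp: acc)
qed

lemma sat_DiaTo_pair:
  assumes "(v, a) \<in> pairs" and s: "represents v s (truth_set pair_model \<phi>)"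
  shows "sat pair_model (DiaTo \<phi> \<psi>) (v, a) \<longleftrightarrow>
    (\<exists>b. (a, s, b) \<in> relI (str K v) \<and> sat pair_model \<psi> (v, b))"
proof -
  let ?T = "truth_set pair_model \<phi>"
  have v: "v \<in> cone" using assms(1) pairsD by blast
  have "((v, a), ?T, y) \<in> acc pair_model \<longleftrightarrow> (\<exists>b. y = (v, b) \<and> (a, s, b) \<in> relI (str K v))" for y
    using s represents_unique[OF v] v by (auto simp: pair_model_simps)
  then show ?thesis by auto
qed


section \<open>Set elements for all truth sets\<close>

lemma represents_elemI:
  assumes "represents v s X" "(v, u) \<in> ord K" "a \<in> objI (str K u)"
  shows "(a, hom K v u s) \<in> elemI (str K u) \<longleftrightarrow> (u, a) \<in> X"
  using assms by (simp add: represents_def)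

lemma represents_setI: "represents v s X \<Longrightarrow> s \<in> setI (str K v)"
  by (simp add: represents_def)

lemma represents_self:
  assumes "represents v s X" "v \<in> cone" "a \<in> objI (str K v)"
  shows "(a, s) \<in> elemI (str K v) \<longleftrightarrow> (v, a) \<in> X"
  using represents_elemI[OF assms(1) _ assms(3)] represents_setI[OF assms(1)] cone_nodes[OF assms(2)]
  by (simp add: ord_refl hom_id setI_dom)

text \<open>All transport between nodes is absorbed here. What remains for each axiom is to evaluate
  \<open>\<chi>\<close> at one node, where the values of variables 0 and 1 already represent
  \<open>X\<close> and \<open>Y\<close>.\<close>

lemma represents_comprehension:
  assumes "FAll 0 (FAll 1 ((SetA 0 \<^bold>\<and> SetA 1) \<^bold>\<longrightarrow>
      FEx 2 (SetA 2 \<^bold>\<and> FAllO 3 (ElemA 3 2 \<^bold>\<longleftrightarrow> \<chi>)))) \<in> Th"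
    and v: "v \<in> cone" and s: "represents v s X" and t: "represents v t Y"
    and \<chi>: "\<And>u h. u \<in> cone \<Longrightarrow> asg u h \<Longrightarrow> h 3 \<in> objI (str K u) \<Longrightarrow> (u, h 3) \<in> pairs \<Longrightarrow>
      represents u (h 0) X \<Longrightarrow> represents u (h 1) Y \<Longrightarrow> fosat K \<chi> u h \<longleftrightarrow> (u, h 3) \<in> Z"
  shows "\<exists>z. represents v z Z"
proof -
  obtain g z where g: "asg v g" "g 0 = s" "g 1 = t" "z \<in> setI (str K v)"
    and z: "\<And>u a. (v, u) \<in> ord K \<Longrightarrow> a \<in> objI (str K u) \<Longrightarrow>
      (a, hom K v u z) \<in> elemI (str K u) \<longleftrightarrow> fosat K \<chi> u ((hom K v u \<circ> g)(3 := a))"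
    using binary_comprehension[OF assms(1) v represents_setI[OF s] represents_setI[OF t]] by blast
  have "(a, hom K v u z) \<in> elemI (str K u) \<longleftrightarrow> (u, a) \<in> Z"
    if u: "(v, u) \<in> ord K" and a: "a \<in> objI (str K u)" for u a
  proof -
    let ?h = "(hom K v u \<circ> g)(3 := a)"
    have cone: "u \<in> cone" using v u by (rule cone_up)
    then have dom: "a \<in> dom (str K u)" using a objI_dom cone_nodes by blast
    have "fosat K \<chi> u ?h \<longleftrightarrow> (u, ?h 3) \<in> Z"
    proof (rule \<chi>[OF cone])
      show "asg u ?h" using asg_hom[OF g(1) u] dom by (rule asg_upd)
      show "represents u (?h 0) X" "represents u (?h 1) Y"
        using represents_up[OF v s u] represents_up[OF v t u] g(2,3) by simp_all
    qed (use cone a dom in \<open>simp_all add: pairs_def\<close>)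
    then show ?thesis using z[OF u a] by simp
  qed
  then show ?thesis
    using g(4) by (auto simp: represents_def)
qed

text \<open>The existence axioms of \<open>Th\<close> are the closure conditions of this induction,
  one for each way of forming a formula.\<close>

lemma comprehension: "v \<in> cone \<Longrightarrow> \<exists>s. represents v s (truth_set pair_model \<phi>)"
proof (induction \<phi> arbitrary: v)
  case Top
  have "FEx 0 (SetA 0 \<^bold>\<and> FAllO 1 (ElemA 1 0)) \<in> Th"
    unfolding Th_def Let_def by blast
  then obtain g where "asg v g" "fosat K (FEx 0 (SetA 0 \<^bold>\<and> FAllO 1 (ElemA 1 0))) v g"
    using Th_cone Top by blast
  then obtain s where s: "s \<in> setI (str K v)" "fosat K (FAllO 1 (ElemA 1 0)) v (g(0 := s))"
    "asg v (g(0 := s))"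
    unfolding fosat.simps(6,9,13) using asg_upd by auto
  have "(a, hom K v u s) \<in> elemI (str K u)" "(u, a) \<in> pairs"
    if "(v, u) \<in> ord K" "a \<in> objI (str K u)" for u a
    using s(2)[unfolded FAll_FImp_iff[OF s(3)]] that cone_up[OF Top that(1)] objI_dom[OF _ that(2)]
      cone_nodes
    by (auto simp: pairs_def)
  then show ?case using s(1) by (auto simp: represents_def pair_model_simps)
next
  case Bot
  have "FEx 0 (SetA 0 \<^bold>\<and> FAll 1 (\<^bold>\<not> (ElemA 1 0))) \<in> Th"
    unfolding Th_def Let_def by blast
  then obtain g where "asg v g" "fosat K (FEx 0 (SetA 0 \<^bold>\<and> FAll 1 (\<^bold>\<not> (ElemA 1 0)))) v g"
    using Th_cone Bot by blast
  then obtain s where s: "s \<in> setI (str K v)" "fosat K (FAll 1 (\<^bold>\<not> (ElemA 1 0))) v (g(0 := s))"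
    "asg v (g(0 := s))"
    unfolding fosat.simps(6,9,13) using asg_upd by auto
  have "(a, hom K v u s) \<notin> elemI (str K u)"
    if "(v, u) \<in> ord K" "a \<in> objI (str K u)" for u a
    using s(2)[unfolded FAll_FImp_iff[OF s(3)]] that cone_up[OF Bot that(1)] objI_dom[OF _ that(2)]
      cone_nodes
    by auto
  then show ?case using s(1) by (auto simp: represents_def)
next
  case (Var p)
  let ?A = "FAll 1 (ElemA 1 0 \<^bold>\<longleftrightarrow> PredA p 1)"
  have "FEx 0 (SetA 0 \<^bold>\<and> ?A) \<in> Th"
    unfolding Th_def Let_def by blast
  then obtain g where "asg v g" "fosat K (FEx 0 (SetA 0 \<^bold>\<and> ?A)) v g"
    using Th_cone Var by blast
  then obtain s where s: "s \<in> setI (str K v)" "fosat K ?A v (g(0 := s))"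
    "asg v (g(0 := s))"
    unfolding fosat.simps(6,9,13) using asg_upd by auto
  have "(a, hom K v u s) \<in> elemI (str K u) \<longleftrightarrow> a \<in> predI (str K u) p" "(u, a) \<in> pairs" "u \<in> cone"
    if u: "(v, u) \<in> ord K" "a \<in> objI (str K u)" for u a
  proof -
    show cone: "u \<in> cone" using Var u(1) by (rule cone_up)
    then have n: "u \<in> nodes K" "a \<in> dom (str K u)" using cone_nodes u objI_dom by blast+
    then show "(u, a) \<in> pairs" using cone by (simp add: pairs_def)
    let ?h = "(hom K v u \<circ> g(0 := s))(1 := a)"
    have "fosat K (ElemA 1 0 \<^bold>\<longleftrightarrow> PredA p 1) u ?h"
      using s(2) u(1) n(2) unfolding fosat.simps(12) by blast
    moreover have "asg u ?h"
      using n(2) asg_upd asg_hom[OF s(3) u(1)] by blast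
    ultimately have "fosat K (ElemA 1 0) u ?h \<longleftrightarrow> fosat K (PredA p 1) u ?h"
      using n(1) FIff_D by blast
    then show "(a, hom K v u s) \<in> elemI (str K u) \<longleftrightarrow> a \<in> predI (str K u) p" by simp
  qed
  then show ?case using s(1) by (auto simp: represents_def pair_model_simps)
next
  case (Conj \<phi> \<psi>)
  then obtain s t where st: "represents v s (truth_set pair_model \<phi>)"
    "represents v t (truth_set pair_model \<psi>)"
    by blast
  have "FAll 0 (FAll 1 ((SetA 0 \<^bold>\<and> SetA 1) \<^bold>\<longrightarrow>
      FEx 2 (SetA 2 \<^bold>\<and> FAllO 3 (ElemA 3 2 \<^bold>\<longleftrightarrow> (ElemA 3 0 \<^bold>\<and> ElemA 3 1))))) \<in> Th"
    unfolding Th_def Let_def by blast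
  then show ?case
    using Conj.prems st
  proof (rule represents_comprehension)
    fix u h
    assume u: "u \<in> cone" "asg u h" "h 3 \<in> objI (str K u)" "(u, h 3) \<in> pairs"
      and st: "represents u (h 0) (truth_set pair_model \<phi>)"
        "represents u (h 1) (truth_set pair_model \<psi>)"
    show "fosat K (ElemA 3 0 \<^bold>\<and> ElemA 3 1) u h \<longleftrightarrow> (u, h 3) \<in> truth_set pair_model (Conj \<phi> \<psi>)"
      using u(4) represents_self[OF st(1) u(1,3)] represents_self[OF st(2) u(1,3)]
      by (simp add: pair_model_simps)
  qed
next
  case (Disj \<phi> \<psi>)
  then obtain s t where st: "represents v s (truth_set pair_model \<phi>)"
    "represents v t (truth_set pair_model \<psi>)"
    by blast
  have "FAll 0 (FAll 1 ((SetA 0 \<^bold>\<and> SetA 1) \<^bold>\<longrightarrow>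
      FEx 2 (SetA 2 \<^bold>\<and> FAllO 3 (ElemA 3 2 \<^bold>\<longleftrightarrow> (ElemA 3 0 \<^bold>\<or> ElemA 3 1))))) \<in> Th"
    unfolding Th_def Let_def by blast
  then show ?case
    using Disj.prems st
  proof (rule represents_comprehension)
    fix u h
    assume u: "u \<in> cone" "asg u h" "h 3 \<in> objI (str K u)" "(u, h 3) \<in> pairs"
      and st: "represents u (h 0) (truth_set pair_model \<phi>)"
        "represents u (h 1) (truth_set pair_model \<psi>)"
    show "fosat K (ElemA 3 0 \<^bold>\<or> ElemA 3 1) u h \<longleftrightarrow> (u, h 3) \<in> truth_set pair_model (Disj \<phi> \<psi>)"
      using u(4) represents_self[OF st(1) u(1,3)] represents_self[OF st(2) u(1,3)]
      by (simp add: pair_model_simps)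
  qed
next
  case (Impl \<phi> \<psi>)
  then obtain s t where st: "represents v s (truth_set pair_model \<phi>)"
    "represents v t (truth_set pair_model \<psi>)"
    by blast
  have "FAll 0 (FAll 1 ((SetA 0 \<^bold>\<and> SetA 1) \<^bold>\<longrightarrow>
      FEx 2 (SetA 2 \<^bold>\<and> FAllO 3 (ElemA 3 2 \<^bold>\<longleftrightarrow> (ElemA 3 0 \<^bold>\<longrightarrow> ElemA 3 1))))) \<in> Th"
    unfolding Th_def Let_def by blast
  then show ?case
    using Impl.prems st
  proof (rule represents_comprehension)
    fix u h
    assume u: "u \<in> cone" "asg u h" "h 3 \<in> objI (str K u)" "(u, h 3) \<in> pairs"
      and st: "represents u (h 0) (truth_set pair_model \<phi>)"
        "represents u (h 1) (truth_set pair_model \<psi>)"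
    have "(hom K u t (h 3), hom K u t (h 0)) \<in> elemI (str K t) \<longleftrightarrow> sat pair_model \<phi> (t, hom K u t (h 3))"
      "(hom K u t (h 3), hom K u t (h 1)) \<in> elemI (str K t) \<longleftrightarrow> sat pair_model \<psi> (t, hom K u t (h 3))"
      if t: "(u, t) \<in> ord K" for t
      using represents_elemI[OF st(1) t hom_objI[OF t u(3)]]
        represents_elemI[OF st(2) t hom_objI[OF t u(3)]] pairs_up[OF u(4) t]
      by (simp_all add: pair_model_simps)
    then show "fosat K (ElemA 3 0 \<^bold>\<longrightarrow> ElemA 3 1) u h \<longleftrightarrow>
        (u, h 3) \<in> truth_set pair_model (Impl \<phi> \<psi>)"
      using u(4) sat_Impl_pair[OF u(4)] by (simp add: pair_model_simps(1) del: sat.simps)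
  qed
next
  case (BoxTo \<phi> \<psi>)
  then obtain s t where st: "represents v s (truth_set pair_model \<phi>)"
    "represents v t (truth_set pair_model \<psi>)"
    by blast
  let ?\<chi> = "FAll 4 (RelA 3 0 4 \<^bold>\<longrightarrow> ElemA 4 1)"
  have "FAll 0 (FAll 1 ((SetA 0 \<^bold>\<and> SetA 1) \<^bold>\<longrightarrow>
      FEx 2 (SetA 2 \<^bold>\<and> FAllO 3 (ElemA 3 2 \<^bold>\<longleftrightarrow> ?\<chi>)))) \<in> Th"
    unfolding Th_def Let_def by blast
  then show ?case
    using BoxTo.prems st
  proof (rule represents_comprehension)
    fix u h
    assume u: "u \<in> cone" "asg u h" "h 3 \<in> objI (str K u)" "(u, h 3) \<in> pairs"
      and st: "represents u (h 0) (truth_set pair_model \<phi>)"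
        "represents u (h 1) (truth_set pair_model \<psi>)"
    \<comment> \<open>By the sort axiom for \<open>R\<close> the successor \<open>b\<close> is an
      object, so membership in the second set coincides with truth of \<open>\<psi>\<close> at
      \<open>b\<close>.\<close>
    have R: "b \<in> dom (str K t)"
      "(b, hom K u t (h 1)) \<in> elemI (str K t) \<longleftrightarrow> sat pair_model \<psi> (t, b)"
      if t: "(u, t) \<in> ord K" and R: "(hom K u t (h 3), hom K u t (h 0), b) \<in> relI (str K t)" for t b
    proof -
      have "t \<in> cone" using u(1) t by (rule cone_up)
      then have b: "b \<in> objI (str K t)" "b \<in> dom (str K t)" "(t, b) \<in> pairs"
        using relI_sorts[OF _ R] objI_dom cone_nodes by (auto simp: pairs_def)
      then show "b \<in> dom (str K t)"
        "(b, hom K u t (h 1)) \<in> elemI (str K t) \<longleftrightarrow> sat pair_model \<psi> (t, b)"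
        using represents_elemI[OF st(2) t b(1)] by (simp_all add: pair_model_simps)
    qed
    show "fosat K ?\<chi> u h \<longleftrightarrow> (u, h 3) \<in> truth_set pair_model (BoxTo \<phi> \<psi>)"
      unfolding FAll_FImp_iff[OF u(2)] mem_Collect_eq sat_BoxTo_pair[OF u(4) st(1)]
      using u(4) by (auto simp: R[unfolded One_nat_def] pair_model_simps(1))
  qed
next
  case (DiaTo \<phi> \<psi>)
  then obtain s t where st: "represents v s (truth_set pair_model \<phi>)"
    "represents v t (truth_set pair_model \<psi>)"
    by blast
  let ?\<chi> = "FEx 4 (RelA 3 0 4 \<^bold>\<and> ElemA 4 1)"
  have "FAll 0 (FAll 1 ((SetA 0 \<^bold>\<and> SetA 1) \<^bold>\<longrightarrow>
      FEx 2 (SetA 2 \<^bold>\<and> FAllO 3 (ElemA 3 2 \<^bold>\<longleftrightarrow> ?\<chi>)))) \<in> Th"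
    unfolding Th_def Let_def by blast
  then show ?case
    using DiaTo.prems st
  proof (rule represents_comprehension)
    fix u h
    assume u: "u \<in> cone" "asg u h" "h 3 \<in> objI (str K u)" "(u, h 3) \<in> pairs"
      and st: "represents u (h 0) (truth_set pair_model \<phi>)"
        "represents u (h 1) (truth_set pair_model \<psi>)"
    have R: "b \<in> dom (str K u)" "(b, h 1) \<in> elemI (str K u) \<longleftrightarrow> sat pair_model \<psi> (u, b)"
      if R: "(h 3, h 0, b) \<in> relI (str K u)" for b
    proof -
      have b: "b \<in> objI (str K u)" "b \<in> dom (str K u)" "(u, b) \<in> pairs"
        using relI_sorts[OF u(1) R] objI_dom cone_nodes[OF u(1)] u(1) by (auto simp: pairs_def)
      then show "b \<in> dom (str K u)" "(b, h 1) \<in> elemI (str K u) \<longleftrightarrow> sat pair_model \<psi> (u, b)"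
        using represents_self[OF st(2) u(1) b(1)] by (simp_all add: pair_model_simps)
    qed
    show "fosat K ?\<chi> u h \<longleftrightarrow> (u, h 3) \<in> truth_set pair_model (DiaTo \<phi> \<psi>)"
      unfolding mem_Collect_eq sat_DiaTo_pair[OF u(4) st(1)]
      using u(4) by (auto simp: R[unfolded One_nat_def] pair_model_simps(1))
  qed
qed

section \<open>Truth of the translation in the pair model\<close>

text \<open>The part of the conditional clauses of \<open>ST\<close> that pins down
  \<open>y\<close>. Its equivalence ranges over the objects at all nodes above \<open>v\<close>,
  exactly as \<open>represents\<close> does; \<open>y \<noteq> z\<close> keeps \<open>s\<close>
  visible below the quantifier.\<close>

lemma fosat_represents:
  assumes v: "v \<in> cone" and g: "asg v g" and s: "s \<in> dom (str K v)"
    and yz: "y \<noteq> z"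
    and IH: "\<And>u h. u \<in> cone \<Longrightarrow> asg u h \<Longrightarrow> fosat K \<chi> u h \<longleftrightarrow> sat pair_model \<phi> (u, h z)"
  shows "fosat K (SetA y \<^bold>\<and> FAllO z (ElemA z y \<^bold>\<longleftrightarrow> \<chi>)) v (g(y := s)) \<longleftrightarrow>
    represents v s (truth_set pair_model \<phi>)"
proof -
  have asg: "asg v (g(y := s))" using g s by (rule asg_upd)
  have "fosat K \<chi> u ((hom K v u \<circ> g(y := s))(z := a)) \<longleftrightarrow> (u, a) \<in> truth_set pair_model \<phi>"
    if u: "(v, u) \<in> ord K" and a: "a \<in> objI (str K u)" for u a
  proof -
    have cone: "u \<in> cone" using v u by (rule cone_up)
    then have dom: "a \<in> dom (str K u)" using a objI_dom cone_nodes by blast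
    show ?thesis
      using IH[OF cone asg_upd[OF asg_hom[OF asg u] dom]] cone dom
      by (simp add: pair_model_simps pairs_def)
  qed
  then show ?thesis
    using yz unfolding fosat.simps(9) FAllO_FIff_iff[OF asg] represents_def by auto
qed

theorem fosat_ST:
  "v \<in> cone \<Longrightarrow> asg v g \<Longrightarrow> fosat K (ST x \<phi>) v g \<longleftrightarrow> sat pair_model \<phi> (v, g x)"
proof (induction \<phi> arbitrary: v g x)
  case (Var p)
  then show ?case by (simp add: pair_model_simps)
next
  case (Impl \<phi> \<psi>)
  have pair: "(v, g x) \<in> pairs" using Impl.prems by (simp add: pairs_def asg_def)
  have "fosat K (ST x \<phi>) u (hom K v u \<circ> g) \<longleftrightarrow> sat pair_model \<phi> (u, hom K v u (g x))"
    "fosat K (ST x \<psi>) u (hom K v u \<circ> g) \<longleftrightarrow> sat pair_model \<psi> (u, hom K v u (g x))"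
    if u: "(v, u) \<in> ord K" for u
    using Impl.IH(1)[OF cone_up[OF Impl.prems(1) u] asg_hom[OF Impl.prems(2) u], of x]
      Impl.IH(2)[OF cone_up[OF Impl.prems(1) u] asg_hom[OF Impl.prems(2) u], of x]
    by (simp_all add: comp_def)
  then show ?case
    unfolding sat_Impl_pair[OF pair] by simp
next
  case (BoxTo \<phi> \<psi>)
  let ?y = "x + 1" and ?z = "x + 2" and ?w = "x + 3"
  let ?R = "\<lambda>s. \<forall>u b. (v, u) \<in> ord K \<longrightarrow>
    (hom K v u (g x), hom K v u s, b) \<in> relI (str K u) \<longrightarrow> sat pair_model \<psi> (u, b)"
  have pair: "(v, g x) \<in> pairs" using BoxTo.prems by (simp add: pairs_def asg_def)
  have "fosat K (FAll ?w (RelA x ?y ?w \<^bold>\<longrightarrow> ST ?w \<psi>)) v (g(?y := s)) \<longleftrightarrow> ?R s"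
    if s: "s \<in> dom (str K v)" for s
  proof -
    have asg: "asg v (g(?y := s))" using BoxTo.prems(2) s by (rule asg_upd)
    have "fosat K (ST ?w \<psi>) u ((hom K v u \<circ> g(?y := s))(?w := b)) \<longleftrightarrow> sat pair_model \<psi> (u, b)"
      if u: "(v, u) \<in> ord K" and b: "b \<in> dom (str K u)" for u b
    proof -
      have "asg u ((hom K v u \<circ> g(?y := s))(?w := b))" using asg_upd asg_hom asg u b by blast
      from BoxTo.IH(2)[OF cone_up[OF BoxTo.prems(1) u] this, of ?w] show ?thesis by (simp add: fun_upd_def)
    qed
    moreover have "b \<in> dom (str K u)" if "(v, u) \<in> ord K" "(c, d, b) \<in> relI (str K u)" for u b c d
      using that relI_dom ord_nodes by blast
    ultimately show ?thesis
      unfolding FAll_FImp_iff[OF asg] by auto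
  qed
  moreover have "fosat K (SetA ?y \<^bold>\<and> FAllO ?z (ElemA ?z ?y \<^bold>\<longleftrightarrow> ST ?z \<phi>)) v (g(?y := s)) \<longleftrightarrow>
      represents v s (truth_set pair_model \<phi>)" if "s \<in> dom (str K v)" for s
    by (rule fosat_represents[OF BoxTo.prems that _ BoxTo.IH(1)]) simp_all
  ultimately have "(\<exists>s\<in>dom (str K v).
      fosat K (SetA ?y \<^bold>\<and> FAllO ?z (ElemA ?z ?y \<^bold>\<longleftrightarrow> ST ?z \<phi>)) v (g(?y := s)) \<and>
      fosat K (FAll ?w (RelA x ?y ?w \<^bold>\<longrightarrow> ST ?w \<psi>)) v (g(?y := s))) \<longleftrightarrow>
      (\<exists>s\<in>dom (str K v). represents v s (truth_set pair_model \<phi>) \<and> ?R s)"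
    by (simp only: cong: bex_cong)
  then have "fosat K (ST x (BoxTo \<phi> \<psi>)) v g \<longleftrightarrow>
      (\<exists>s\<in>dom (str K v). represents v s (truth_set pair_model \<phi>) \<and> ?R s)"
    unfolding ST.simps Let_def fosat.simps(9,13) conj_assoc .
  \<comment> \<open>\<open>comprehension\<close> supplies a representative when the box is true;
    conversely, whichever one is given computes the truth value of the box.\<close>
  also have "\<dots> \<longleftrightarrow> sat pair_model (BoxTo \<phi> \<psi>) (v, g x)"
    using comprehension[OF BoxTo.prems(1), of \<phi>] sat_BoxTo_pair[OF pair]
      represents_setI setI_dom[OF cone_nodes[OF BoxTo.prems(1)]] by blast
  finally show ?case .
next
  case (DiaTo \<phi> \<psi>)
  let ?y = "x + 1" and ?z = "x + 2" and ?w = "x + 3"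
  let ?R = "\<lambda>s. \<exists>b. (g x, s, b) \<in> relI (str K v) \<and> sat pair_model \<psi> (v, b)"
  have pair: "(v, g x) \<in> pairs" using DiaTo.prems by (simp add: pairs_def asg_def)
  have "fosat K (FEx ?w (RelA x ?y ?w \<^bold>\<and> ST ?w \<psi>)) v (g(?y := s)) \<longleftrightarrow> ?R s"
    if s: "s \<in> dom (str K v)" for s
  proof -
    have asg: "asg v (g(?y := s))" using DiaTo.prems(2) s by (rule asg_upd)
    have "fosat K (ST ?w \<psi>) v (g(?y := s, ?w := b)) \<longleftrightarrow> sat pair_model \<psi> (v, b)"
      if b: "b \<in> dom (str K v)" for b
    proof -
      have "asg v (g(?y := s, ?w := b))" using asg b by (rule asg_upd)
      from DiaTo.IH(2)[OF DiaTo.prems(1) this, of ?w] show ?thesis by (simp add: fun_upd_def)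
    qed
    moreover have "b \<in> dom (str K v)" if "(c, d, b) \<in> relI (str K v)" for b c d
      using that relI_dom cone_nodes[OF DiaTo.prems(1)] by blast
    ultimately show ?thesis by auto
  qed
  moreover have "fosat K (SetA ?y \<^bold>\<and> FAllO ?z (ElemA ?z ?y \<^bold>\<longleftrightarrow> ST ?z \<phi>)) v (g(?y := s)) \<longleftrightarrow>
      represents v s (truth_set pair_model \<phi>)" if "s \<in> dom (str K v)" for s
    by (rule fosat_represents[OF DiaTo.prems that _ DiaTo.IH(1)]) simp_all
  ultimately have "(\<exists>s\<in>dom (str K v).
      fosat K (SetA ?y \<^bold>\<and> FAllO ?z (ElemA ?z ?y \<^bold>\<longleftrightarrow> ST ?z \<phi>)) v (g(?y := s)) \<and>
      fosat K (FEx ?w (RelA x ?y ?w \<^bold>\<and> ST ?w \<psi>)) v (g(?y := s))) \<longleftrightarrow>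
      (\<exists>s\<in>dom (str K v). represents v s (truth_set pair_model \<phi>) \<and> ?R s)"
    by (simp only: cong: bex_cong)
  then have "fosat K (ST x (DiaTo \<phi> \<psi>)) v g \<longleftrightarrow>
      (\<exists>s\<in>dom (str K v). represents v s (truth_set pair_model \<phi>) \<and> ?R s)"
    unfolding ST.simps Let_def fosat.simps(9,13) conj_assoc .
  also have "\<dots> \<longleftrightarrow> sat pair_model (DiaTo \<phi> \<psi>) (v, g x)"
    using comprehension[OF DiaTo.prems(1), of \<phi>] sat_DiaTo_pair[OF pair]
      represents_setI setI_dom[OF cone_nodes[OF DiaTo.prems(1)]] by blast
  finally show ?case .
qed (simp_all add: Let_def)

end

section \<open>From Chellas models to Kripke sheaves\<close>

text \<open>Objects may be added but are never dropped, so the identity can serve as a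
  transition.\<close>

definition below :: "'w chellas \<Rightarrow> ('t \<Rightarrow> 'w option) \<Rightarrow> ('t \<Rightarrow> 'w option) \<Rightarrow> bool" where
  "below M F G \<longleftrightarrow> (\<forall>t v. F t = Some v \<longrightarrow> (\<exists>v'. G t = Some v' \<and> (v, v') \<in> le M))"

text \<open>
  Every node \<open>y\<close> places some of the objects \<open>t\<close> at worlds of the model, and objects move upwards
  along the order. The relation \<open>succ\<close> between objects does not depend on \<open>y\<close>, which makes all
  transition homomorphisms identities.
\<close>

locale saturated_system = chellas M for M :: "'w chellas" +
  fixes Nd :: "'v set" and F :: "'v \<Rightarrow> 't \<Rightarrow> 'w option" and succ :: "'t \<Rightarrow> fm \<Rightarrow> 't \<Rightarrow> bool"
    and eo :: "'t \<Rightarrow> 'a" and es :: "'w set \<Rightarrow> 'a"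
  assumes inj_eo: "inj eo" and inj_es: "inj_on es (range (truth_set M))"
    and eo_es: "eo t \<noteq> es (truth_set M \<phi>)"
    and Nd: "Nd \<noteq> {}"
    and F_worlds: "y \<in> Nd \<Longrightarrow> F y t = Some v \<Longrightarrow> v \<in> worlds M"
    and succ_acc: "y \<in> Nd \<Longrightarrow> succ s \<phi> t \<Longrightarrow> F y t = Some v \<Longrightarrow>
      \<exists>u. F y s = Some u \<and> (u, truth_set M \<phi>, v) \<in> acc M"
    and saturated: "y \<in> Nd \<Longrightarrow> F y s = Some u \<Longrightarrow> (u, truth_set M \<phi>, v) \<in> acc M \<Longrightarrow>
      \<exists>t. succ s \<phi> t \<and> F y t = Some v"
    and inhabited: "y \<in> Nd \<Longrightarrow> w \<in> worlds M \<Longrightarrow> \<exists>t. F y t = Some w"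
    and extend: "y \<in> Nd \<Longrightarrow> F y t = Some v \<Longrightarrow> (v, w) \<in> le M \<Longrightarrow>
      \<exists>y'\<in>Nd. below M (F y) (F y') \<and> F y' t = Some w"
begin

section \<open>The sheaf of a saturated system\<close>

abbreviation D :: "'w set set" where
  "D \<equiv> range (truth_set M)"

text \<open>All nodes share the set elements, one for each truth set, and differ in which objects
  they place and where. An edge is present as soon as its target is placed, because
  \<open>succ_acc\<close> then places its source. Formulas with the same truth set yield the same
  middle argument of \<open>R\<close>.\<close>

definition K :: "('v, 'a) sheaf" where
  "K = \<lparr>nodes = Nd,
     ord = {(y, y'). y \<in> Nd \<and> y' \<in> Nd \<and> below M (F y) (F y')},
     str = (\<lambda>y. \<lparr>dom = {eo t |t. F y t \<noteq> None} \<union> es ` D,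
       predI = (\<lambda>p. {eo t |t v. F y t = Some v \<and> v \<in> val M p}),
       objI = {eo t |t. F y t \<noteq> None},
       setI = es ` D,
       elemI = {(eo t, es X) |t X v. X \<in> D \<and> F y t = Some v \<and> v \<in> X},
       relI = {(eo s, es (truth_set M \<phi>), eo t) |s \<phi> t. succ s \<phi> t \<and> F y t \<noteq> None}\<rparr>),
     hom = (\<lambda>_ _ a. a)\<rparr>"

lemma eo_eq: "eo s = eo t \<longleftrightarrow> s = t"
  using inj_eo by (simp add: inj_eq)

lemma es_eq: "X \<in> D \<Longrightarrow> Y \<in> D \<Longrightarrow> es X = es Y \<longleftrightarrow> X = Y"
  using inj_es by (auto simp: inj_on_def)

lemma eo_neq_es: "X \<in> D \<Longrightarrow> eo t \<noteq> es X" "X \<in> D \<Longrightarrow> es X \<noteq> eo t"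
  using eo_es by (auto dest: sym)

lemma K_simps:
  "nodes K = Nd"
  "(y, y') \<in> ord K \<longleftrightarrow> y \<in> Nd \<and> y' \<in> Nd \<and> below M (F y) (F y')"
  "a \<in> dom (str K y) \<longleftrightarrow> a \<in> objI (str K y) \<or> a \<in> setI (str K y)"
  "a \<in> predI (str K y) p \<longleftrightarrow> (\<exists>t v. a = eo t \<and> F y t = Some v \<and> v \<in> val M p)"
  "a \<in> objI (str K y) \<longleftrightarrow> (\<exists>t v. a = eo t \<and> F y t = Some v)"
  "a \<in> setI (str K y) \<longleftrightarrow> (\<exists>X\<in>D. a = es X)"
  "(a, b) \<in> elemI (str K y) \<longleftrightarrow> (\<exists>t X v. a = eo t \<and> b = es X \<and> X \<in> D \<and> F y t = Some v \<and> v \<in> X)"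
  "(a, b, c) \<in> relI (str K y) \<longleftrightarrow>
     (\<exists>s \<phi> t v. a = eo s \<and> b = es (truth_set M \<phi>) \<and> c = eo t \<and> succ s \<phi> t \<and> F y t = Some v)"
  "hom K y y' = (\<lambda>a. a)"
  by (auto simp: K_def)

lemma hom_K [simp]: "hom K y y' a = a" "hom K y y' \<circ> g = g"
  by (auto simp: K_simps)

lemma K_elemI:
  "X \<in> D \<Longrightarrow> F y t = Some v \<Longrightarrow> (eo t, es X) \<in> elemI (str K y) \<longleftrightarrow> v \<in> X"
  unfolding K_simps using es_eq eo_eq by auto

lemma K_predI: "F y t = Some v \<Longrightarrow> eo t \<in> predI (str K y) p \<longleftrightarrow> v \<in> val M p"
  unfolding K_simps using eo_eq by auto

text \<open>The edge may stem from a label \<open>\<psi>\<close> other than \<open>\<phi>\<close>.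
  Injectivity of \<open>es\<close> recovers the truth set only, which is all that \<open>acc\<close>
  depends on.\<close>

lemma relI_obtain:
  assumes "y \<in> Nd" "(eo s, es (truth_set M \<phi>), b) \<in> relI (str K y)"
  obtains t u v where "b = eo t" "F y s = Some u" "F y t = Some v" "(u, truth_set M \<phi>, v) \<in> acc M"
proof -
  obtain s' \<psi> t v where t: "eo s = eo s'" "es (truth_set M \<phi>) = es (truth_set M \<psi>)" "b = eo t"
    "succ s' \<psi> t" "F y t = Some v"
    using assms(2) unfolding K_simps by blast
  have "s' = s" "truth_set M \<psi> = truth_set M \<phi>"
    using t(1,2) eo_eq es_eq[of "truth_set M \<psi>" "truth_set M \<phi>"] by auto
  then show ?thesis
    using that t succ_acc[OF assms(1) t(4,5)] by auto
qed

lemma relI_intro: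
  assumes "y \<in> Nd" "F y s = Some u" "(u, truth_set M \<phi>, v) \<in> acc M"
  obtains t where "F y t = Some v" "(eo s, es (truth_set M \<phi>), eo t) \<in> relI (str K y)"
  using saturated[OF assms] that unfolding K_simps by blast

lemma relI_objI:
  assumes "y \<in> Nd" "(a, b, c) \<in> relI (str K y)"
  shows "a \<in> objI (str K y)" "b \<in> setI (str K y)" "c \<in> objI (str K y)"
proof -
  obtain s \<phi> t v where "a = eo s" "b = es (truth_set M \<phi>)" "c = eo t" "succ s \<phi> t" "F y t = Some v"
    using assms(2) unfolding K_simps by blast
  moreover from this obtain u where "F y s = Some u" using succ_acc[OF assms(1)] by blast
  ultimately show "a \<in> objI (str K y)" "b \<in> setI (str K y)" "c \<in> objI (str K y)"
    unfolding K_simps by blast+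
qed

lemma belowD: "(y, y') \<in> ord K \<Longrightarrow> F y t = Some v \<Longrightarrow> \<exists>v'. F y' t = Some v' \<and> (v, v') \<in> le M"
  by (simp add: K_simps below_def)

lemma D_up: "X \<in> D \<Longrightarrow> v \<in> X \<Longrightarrow> (v, v') \<in> le M \<Longrightarrow> v' \<in> X"
  using sat_mono le_worlds by auto

text \<open>Predicates and membership persist because truth is upward closed, edges because
  \<open>succ\<close> is fixed and a placed target stays placed.\<close>

lemma homomorphism_K: "(y, y') \<in> ord K \<Longrightarrow> homomorphism (str K y) (str K y') (hom K y y')"
  unfolding homomorphism_def
proof (intro conjI ballI allI; (clarify)?)
  assume y: "(y, y') \<in> ord K"
  show pred: "hom K y y' a \<in> predI (str K y') p" if "a \<in> predI (str K y) p" for p a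
    using that belowD[OF y] val_mono unfolding hom_K K_simps(4) by blast
  show obj: "hom K y y' a \<in> objI (str K y')" if "a \<in> objI (str K y)" for a
    using that belowD[OF y] unfolding hom_K K_simps(5) by blast
  show set: "hom K y y' a \<in> setI (str K y')" if "a \<in> setI (str K y)" for a
    using that unfolding hom_K K_simps(6) by blast
  show "hom K y y' a \<in> dom (str K y')" if "a \<in> dom (str K y)" for a
    using that obj set unfolding K_simps(3) by blast
  show "(hom K y y' a, hom K y y' b) \<in> elemI (str K y')" if "(a, b) \<in> elemI (str K y)" for a b
    using that belowD[OF y] D_up unfolding hom_K K_simps(7) by metis
  show "(hom K y y' a, hom K y y' b, hom K y y' c) \<in> relI (str K y')"
    if "(a, b, c) \<in> relI (str K y)" for a b c
    using that belowD[OF y] unfolding hom_K K_simps(8) by blast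
qed

lemma kripke_sheaf_K: "kripke_sheaf K"
  unfolding kripke_sheaf_def
proof (intro conjI allI impI ballI; (elim conjE)?)
  show "nodes K \<noteq> {}" using Nd by (simp add: K_simps)
  have refl: "below M (F y) (F y)" if "y \<in> Nd" for y
    using F_worlds[OF that] le_refl by (auto simp: below_def)
  have trans: "below M f h" if fg: "below M f g" and gh: "below M g h" for f g h :: "'t \<Rightarrow> 'w option"
    unfolding below_def
  proof (intro allI impI)
    fix t v assume "f t = Some v"
    then obtain v' where "g t = Some v'" "(v, v') \<in> le M" using fg by (auto simp: below_def)
    moreover from this obtain v'' where "h t = Some v''" "(v', v'') \<in> le M"
      using gh by (auto simp: below_def)
    ultimately show "\<exists>v'. h t = Some v' \<and> (v, v') \<in> le M" using le_trans by blast
  qed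
  show "preorder_on (nodes K) (ord K)"
    unfolding preorder_on_def
  proof (intro conjI)
    show "ord K \<subseteq> nodes K \<times> nodes K" by (auto simp: K_simps)
    show "refl_on (nodes K) (ord K)" by (auto simp: refl_on_def K_simps refl)
    show "trans (ord K)"
      by (rule transI) (use trans in \<open>auto simp: K_simps\<close>)
  qed
  show "classical_structure (str K y)" if "y \<in> nodes K" for y
  proof -
    have y: "y \<in> Nd" using that by (simp add: K_simps)
    show ?thesis
      unfolding classical_structure_def
    proof (intro conjI allI)
      show "dom (str K y) \<noteq> {}" by (auto simp: K_def)
      show "predI (str K y) p \<subseteq> dom (str K y)" for p
        unfolding subset_iff K_simps by blast
      show "objI (str K y) \<subseteq> dom (str K y)" "setI (str K y) \<subseteq> dom (str K y)"
        unfolding subset_iff K_simps by blast+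
      show "elemI (str K y) \<subseteq> dom (str K y) \<times> dom (str K y)" by (auto simp: K_def)
      show "relI (str K y) \<subseteq> dom (str K y) \<times> dom (str K y) \<times> dom (str K y)"
        using relI_objI[OF y] K_simps(3) by auto
    qed
  qed
qed (simp_all add: homomorphism_K)

sublocale sheaf K
  by unfold_locales (rule kripke_sheaf_K)

section \<open>Implication and the conditionals evaluated at an object\<close>

text \<open>By \<open>extend\<close>, every world above \<open>v\<close> is the position of
  \<open>t\<close> at some higher node, so ranging over nodes is as strong as ranging over worlds.
  The predicates are abstract because the translation and the comprehension axiom both need
  this.\<close>

lemma sat_Impl_iff:
  assumes y: "y \<in> Nd" "F y t = Some v"
    and P: "\<And>y' v'. (y, y') \<in> ord K \<Longrightarrow> F y' t = Some v' \<Longrightarrow> P y' \<longleftrightarrow> sat M \<phi> v'"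
    and Q: "\<And>y' v'. (y, y') \<in> ord K \<Longrightarrow> F y' t = Some v' \<Longrightarrow> Q y' \<longleftrightarrow> sat M \<psi> v'"
  shows "(\<forall>y'. (y, y') \<in> ord K \<longrightarrow> P y' \<longrightarrow> Q y') \<longleftrightarrow> sat M (Impl \<phi> \<psi>) v" (is "?l \<longleftrightarrow> ?r")
proof
  assume ?l
  show ?r unfolding sat.simps
  proof (intro allI impI)
    fix w assume w: "(v, w) \<in> le M" "sat M \<phi> w"
    obtain y' where "(y, y') \<in> ord K" "F y' t = Some w"
      using extend[OF y w(1)] y(1) unfolding K_simps by blast
    then show "sat M \<psi> w" using \<open>?l\<close> w P Q by blast
  qed
next
  assume ?r
  show ?l
  proof (intro allI impI)
    fix y' assume y': "(y, y') \<in> ord K" "P y'"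
    obtain w where "F y' t = Some w" "(v, w) \<in> le M" using belowD[OF y'(1) y(2)] by blast
    then show "Q y'" using \<open>?r\<close> y' P Q by simp
  qed
qed

text \<open>A world \<open>w\<close> above \<open>v\<close> is reached by moving \<open>t\<close>
  there with \<open>extend\<close>; saturation of the new node then turns a successor of
  \<open>w\<close> into an object.\<close>

lemma sat_BoxTo_iff:
  assumes y: "y \<in> Nd" "F y t = Some v"
    and P: "\<And>y' s u. (y, y') \<in> ord K \<Longrightarrow> F y' s = Some u \<Longrightarrow> P y' (eo s) \<longleftrightarrow> sat M \<psi> u"
  shows "(\<forall>y'. (y, y') \<in> ord K \<longrightarrow> (\<forall>b\<in>dom (str K y').
      (eo t, es (truth_set M \<phi>), b) \<in> relI (str K y') \<longrightarrow> P y' b)) \<longleftrightarrow> sat M (BoxTo \<phi> \<psi>) v"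
    (is "?l \<longleftrightarrow> ?r")
proof
  assume l: ?l
  show ?r unfolding sat.simps
  proof (intro allI impI)
    fix w u assume w: "(v, w) \<in> le M" "(w, truth_set M \<phi>, u) \<in> acc M"
    obtain y' where y': "y' \<in> Nd" "(y, y') \<in> ord K" "F y' t = Some w"
      using extend[OF y w(1)] y(1) unfolding K_simps by blast
    obtain s where s: "F y' s = Some u" "(eo t, es (truth_set M \<phi>), eo s) \<in> relI (str K y')"
      using relI_intro[OF y'(1,3) w(2)] .
    then have "eo s \<in> dom (str K y')" unfolding K_simps by blast
    then show "sat M \<psi> u" using l y' s P by blast
  qed
next
  assume r: ?r
  show ?l
  proof (intro allI impI ballI)
    fix y' b assume y': "(y, y') \<in> ord K" and R: "(eo t, es (truth_set M \<phi>), b) \<in> relI (str K y')"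
    have "y' \<in> Nd" using y' by (simp add: K_simps)
    then obtain s w u where s: "b = eo s" "F y' t = Some w" "F y' s = Some u"
      "(w, truth_set M \<phi>, u) \<in> acc M"
      using R relI_obtain by blast
    have "(v, w) \<in> le M" using belowD[OF y' y(2)] s(2) by auto
    then show "P y' b" using r s P[OF y' s(3)] by auto
  qed
qed

lemma sat_DiaTo_iff:
  assumes y: "y \<in> Nd" "F y t = Some v"
    and P: "\<And>s u. F y s = Some u \<Longrightarrow> P (eo s) \<longleftrightarrow> sat M \<psi> u"
  shows "(\<exists>b\<in>dom (str K y). (eo t, es (truth_set M \<phi>), b) \<in> relI (str K y) \<and> P b) \<longleftrightarrow>
    sat M (DiaTo \<phi> \<psi>) v" (is "?l \<longleftrightarrow> ?r")
proof
  assume ?l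
  then obtain b where b: "(eo t, es (truth_set M \<phi>), b) \<in> relI (str K y)" "P b" by blast
  obtain s w u where s: "b = eo s" "F y t = Some w" "F y s = Some u"
    "(w, truth_set M \<phi>, u) \<in> acc M"
    using y b relI_obtain by blast
  then show ?r using y b P[OF s(3)] by auto
next
  assume ?r
  then obtain u where u: "(v, truth_set M \<phi>, u) \<in> acc M" "sat M \<psi> u" by auto
  obtain s where s: "F y s = Some u" "(eo t, es (truth_set M \<phi>), eo s) \<in> relI (str K y)"
    using relI_intro[OF y u(1)] .
  then have "eo s \<in> dom (str K y)" unfolding K_simps by blast
  then show ?l using s P u by blast
qed

text \<open>Node \<open>y\<close> itself places an object at every world, so agreement of
  \<open>X\<close> and \<open>Y\<close> on placed worlds is already equality. This gives existence
  for the comprehension axioms and uniqueness for extensionality and the clauses of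
  \<open>ST\<close>.\<close>

lemma fosat_comprehension_iff:
  assumes y: "y \<in> Nd" and g: "asg y g" and ij: "i \<noteq> j" and X: "g i = es X" "X \<in> D"
    and \<chi>: "\<And>y' t v. (y, y') \<in> ord K \<Longrightarrow> F y' t = Some v \<Longrightarrow>
      fosat K \<chi> y' (g(j := eo t)) \<longleftrightarrow> v \<in> Y" and Y: "Y \<subseteq> worlds M"
  shows "fosat K (FAllO j (ElemA j i \<^bold>\<longleftrightarrow> \<chi>)) y g \<longleftrightarrow> X = Y"
proof -
  have "fosat K (FAllO j (ElemA j i \<^bold>\<longleftrightarrow> \<chi>)) y g \<longleftrightarrow> (\<forall>y'. (y, y') \<in> ord K \<longrightarrow>
      (\<forall>a\<in>objI (str K y'). (a, es X) \<in> elemI (str K y') \<longleftrightarrow> fosat K \<chi> y' (g(j := a))))"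
    unfolding FAllO_FIff_iff[OF g] using ij X by simp
  also have "\<dots> \<longleftrightarrow> (\<forall>y'. (y, y') \<in> ord K \<longrightarrow> (\<forall>t v. F y' t = Some v \<longrightarrow> (v \<in> X \<longleftrightarrow> v \<in> Y)))"
  proof (intro iff_allI imp_cong refl)
    fix y' assume y': "(y, y') \<in> ord K"
    show "(\<forall>a\<in>objI (str K y'). (a, es X) \<in> elemI (str K y') \<longleftrightarrow> fosat K \<chi> y' (g(j := a))) \<longleftrightarrow>
        (\<forall>t v. F y' t = Some v \<longrightarrow> (v \<in> X \<longleftrightarrow> v \<in> Y))"
    proof -
      have "(\<forall>a\<in>objI (str K y'). (a, es X) \<in> elemI (str K y') \<longleftrightarrow> fosat K \<chi> y' (g(j := a))) \<longleftrightarrow>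
          (\<forall>t v. F y' t = Some v \<longrightarrow>
            ((eo t, es X) \<in> elemI (str K y') \<longleftrightarrow> fosat K \<chi> y' (g(j := eo t))))"
        unfolding Ball_def K_simps(5) by blast
      also have "\<dots> \<longleftrightarrow> (\<forall>t v. F y' t = Some v \<longrightarrow> (v \<in> X \<longleftrightarrow> v \<in> Y))"
        by (intro iff_allI imp_cong refl) (simp only: K_elemI[OF X(2)] \<chi>[OF y'])
      finally show ?thesis .
    qed
  qed
  also have "\<dots> \<longleftrightarrow> X = Y"
  proof
    assume *: "\<forall>y'. (y, y') \<in> ord K \<longrightarrow> (\<forall>t v. F y' t = Some v \<longrightarrow> (v \<in> X \<longleftrightarrow> v \<in> Y))"
    have "(y, y) \<in> ord K" using y ord_refl by (simp add: K_simps(1))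
    then have "v \<in> X \<longleftrightarrow> v \<in> Y" if "v \<in> worlds M" for v
      using * inhabited[OF y that] by blast
    then show "X = Y" using X(2) Y by auto
  qed simp
  finally show ?thesis .
qed

lemma fosat_definition_iff:
  assumes y: "y \<in> Nd" and g: "asg y g" and ij: "i \<noteq> j"
    and \<chi>: "\<And>y' h t v. y' \<in> Nd \<Longrightarrow> asg y' h \<Longrightarrow> h j = eo t \<Longrightarrow> F y' t = Some v \<Longrightarrow>
      fosat K \<chi> y' h \<longleftrightarrow> sat M \<phi> v"
  shows "fosat K (SetA i \<^bold>\<and> FAllO j (ElemA j i \<^bold>\<longleftrightarrow> \<chi>)) y (g(i := a)) \<longleftrightarrow> a = es (truth_set M \<phi>)"
proof (cases "a \<in> setI (str K y)")
  case True
  then obtain X where X: "X \<in> D" "a = es X" unfolding K_simps by blast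
  have asg: "asg y (g(i := a))" using True g asg_upd K_simps(3) by blast
  have "fosat K (FAllO j (ElemA j i \<^bold>\<longleftrightarrow> \<chi>)) y (g(i := a)) \<longleftrightarrow> X = truth_set M \<phi>"
  proof (rule fosat_comprehension_iff[OF y asg ij])
    fix y' t v assume y': "(y, y') \<in> ord K" "F y' t = Some v"
    have n: "y' \<in> Nd" and "eo t \<in> dom (str K y')" using y' unfolding K_simps by blast+
    moreover have "asg y' (g(i := a))" using asg_hom[OF asg y'(1)] by simp
    ultimately have "asg y' (g(i := a, j := eo t))" using asg_upd by blast
    from \<chi>[OF n this _ y'(2)] show "fosat K \<chi> y' (g(i := a, j := eo t)) \<longleftrightarrow> v \<in> truth_set M \<phi>"
      using F_worlds[OF n y'(2)] by simp
  qed (use X in auto)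
  then show ?thesis
    using True X(2) es_eq[OF X(1) rangeI] by (simp only: fosat.simps(6,9) fun_upd_same simp_thms)
next
  case False
  then show ?thesis
    unfolding fosat.simps(6,9) fun_upd_same K_simps(6) by blast
qed

text \<open>In the conditional clauses the formula \<open>?C\<close> leaves \<open>es ?T\<close> as
  the only value of the bound set variable, and the remaining conjunct is the semantic clause for
  the object \<open>t\<close>.\<close>

theorem fosat_ST:
  "y \<in> Nd \<Longrightarrow> asg y g \<Longrightarrow> g x = eo t \<Longrightarrow> F y t = Some v \<Longrightarrow>
    fosat K (ST x \<phi>) y g \<longleftrightarrow> sat M \<phi> v"
proof (induction \<phi> arbitrary: y g x t v)
  case (Var p)
  then show ?case by (simp add: K_predI)
next
  case (Impl \<phi> \<psi>)
  have *: "y' \<in> Nd" "asg y' g" if "(y, y') \<in> ord K" for y'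
    using that asg_hom[OF Impl.prems(2) that] by (simp_all add: K_simps(2))
  show ?case
    unfolding ST.simps fosat.simps hom_K
    by (rule sat_Impl_iff[OF Impl.prems(1,4)])
      (use * Impl.IH Impl.prems(3) in blast)+
next
  case (BoxTo \<phi> \<psi>)
  let ?y = "x + 1" and ?z = "x + 2" and ?w = "x + 3" and ?T = "truth_set M \<phi>"
  let ?C = "SetA ?y \<^bold>\<and> FAllO ?z (ElemA ?z ?y \<^bold>\<longleftrightarrow> ST ?z \<phi>)"
    and ?R = "FAll ?w (RelA x ?y ?w \<^bold>\<longrightarrow> ST ?w \<psi>)"
  have a: "es ?T \<in> dom (str K y)" unfolding K_simps by blast
  then have asg: "asg y (g(?y := es ?T))" using BoxTo.prems(2) by (intro asg_upd)
  have C: "fosat K ?C y (g(?y := a)) \<longleftrightarrow> a = es ?T" for a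
    by (rule fosat_definition_iff[OF BoxTo.prems(1,2) _ BoxTo.IH(1)]) simp_all
  have "fosat K (ST x (BoxTo \<phi> \<psi>)) y g \<longleftrightarrow>
      (\<exists>a\<in>dom (str K y). fosat K ?C y (g(?y := a)) \<and> fosat K ?R y (g(?y := a)))"
    unfolding ST.simps Let_def fosat.simps(9,13) conj_assoc ..
  also have "\<dots> \<longleftrightarrow> fosat K ?R y (g(?y := es ?T))"
    unfolding C using a by blast
  also have "\<dots> \<longleftrightarrow> (\<forall>y'. (y, y') \<in> ord K \<longrightarrow> (\<forall>b\<in>dom (str K y').
      (eo t, es ?T, b) \<in> relI (str K y') \<longrightarrow> fosat K (ST ?w \<psi>) y' (g(?y := es ?T, ?w := b))))"
    unfolding FAll_FImp_iff[OF asg] using BoxTo.prems(3) by simp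
  also have "\<dots> \<longleftrightarrow> sat M (BoxTo \<phi> \<psi>) v"
  proof (rule sat_BoxTo_iff[OF BoxTo.prems(1,4)])
    fix y' s u assume y': "(y, y') \<in> ord K" "F y' s = Some u"
    have n: "y' \<in> Nd" and "eo s \<in> dom (str K y')" using y' unfolding K_simps by blast+
    then have "asg y' (g(?y := es ?T, ?w := eo s))"
      using asg_hom[OF asg y'(1)] asg_upd by simp
    from BoxTo.IH(2)[OF n this, of ?w s u]
    show "fosat K (ST ?w \<psi>) y' (g(?y := es ?T, ?w := eo s)) \<longleftrightarrow> sat M \<psi> u"
      using y'(2) by (simp add: fun_upd_def)
  qed
  finally show ?case .
next
  case (DiaTo \<phi> \<psi>)
  let ?y = "x + 1" and ?z = "x + 2" and ?w = "x + 3" and ?T = "truth_set M \<phi>"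
  let ?C = "SetA ?y \<^bold>\<and> FAllO ?z (ElemA ?z ?y \<^bold>\<longleftrightarrow> ST ?z \<phi>)"
    and ?R = "FEx ?w (RelA x ?y ?w \<^bold>\<and> ST ?w \<psi>)"
  have a: "es ?T \<in> dom (str K y)" unfolding K_simps by blast
  then have asg: "asg y (g(?y := es ?T))" using DiaTo.prems(2) by (intro asg_upd)
  have C: "fosat K ?C y (g(?y := a)) \<longleftrightarrow> a = es ?T" for a
    by (rule fosat_definition_iff[OF DiaTo.prems(1,2) _ DiaTo.IH(1)]) simp_all
  have "fosat K (ST x (DiaTo \<phi> \<psi>)) y g \<longleftrightarrow>
      (\<exists>a\<in>dom (str K y). fosat K ?C y (g(?y := a)) \<and> fosat K ?R y (g(?y := a)))"
    unfolding ST.simps Let_def fosat.simps(9,13) conj_assoc ..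
  also have "\<dots> \<longleftrightarrow> fosat K ?R y (g(?y := es ?T))"
    unfolding C using a by blast
  also have "\<dots> \<longleftrightarrow> (\<exists>b\<in>dom (str K y). (eo t, es ?T, b) \<in> relI (str K y) \<and>
      fosat K (ST ?w \<psi>) y (g(?y := es ?T, ?w := b)))"
    using DiaTo.prems(3) by simp
  also have "\<dots> \<longleftrightarrow> sat M (DiaTo \<phi> \<psi>) v"
  proof (rule sat_DiaTo_iff[OF DiaTo.prems(1,4)])
    fix s u assume s: "F y s = Some u"
    then have "eo s \<in> dom (str K y)" unfolding K_simps by blast
    then have "asg y (g(?y := es ?T, ?w := eo s))" by (rule asg_upd[OF asg])
    from DiaTo.IH(2)[OF DiaTo.prems(1) this, of ?w s u]
    show "fosat K (ST ?w \<psi>) y (g(?y := es ?T, ?w := eo s)) \<longleftrightarrow> sat M \<psi> u"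
      using s by (simp add: fun_upd_def)
  qed
  finally show ?case .
qed (simp_all add: Let_def)

section \<open>Validity of the axioms in the sheaf\<close>

lemma fosat_FAll_I:
  assumes "\<And>y' a. (y, y') \<in> ord K \<Longrightarrow> y' \<in> Nd \<Longrightarrow> asg y' (g(x := a)) \<Longrightarrow>
      a \<in> dom (str K y') \<Longrightarrow> fosat K \<phi> y' (g(x := a))" and "asg y g"
  shows "fosat K (FAll x \<phi>) y g"
  unfolding fosat.simps hom_K
proof (intro allI impI ballI)
  fix y' a assume y': "(y, y') \<in> ord K" and a: "a \<in> dom (str K y')"
  have "asg y' g" using asg_hom[OF assms(2) y'] by simp
  then have "asg y' (g(x := a))" using a by (rule asg_upd)
  then show "fosat K \<phi> y' (g(x := a))" using assms(1)[OF y' _ _ a] y' by (simp add: K_simps(2))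
qed

lemma fosat_FImp_I:
  assumes "\<And>y'. (y, y') \<in> ord K \<Longrightarrow> y' \<in> Nd \<Longrightarrow> asg y' g \<Longrightarrow> fosat K \<phi> y' g \<Longrightarrow> fosat K \<psi> y' g"
    and "asg y g"
  shows "fosat K (\<phi> \<^bold>\<longrightarrow> \<psi>) y g"
  unfolding fosat.simps hom_K
proof (intro allI impI)
  fix y' assume y': "(y, y') \<in> ord K" "fosat K \<phi> y' g"
  have "asg y' g" using asg_hom[OF assms(2) y'(1)] by simp
  then show "fosat K \<psi> y' g" using assms(1) y' by (simp add: K_simps(2))
qed

lemma fosat_FEx_I:
  "a \<in> dom (str K y) \<Longrightarrow> fosat K \<phi> y (g(x := a)) \<Longrightarrow> fosat K (FEx x \<phi>) y g"
  by auto

lemma es_dom: "es (truth_set M \<phi>) \<in> dom (str K y)"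
  unfolding K_simps by blast

lemma es_setI: "es (truth_set M \<phi>) \<in> setI (str K y)"
  unfolding K_simps by blast

text \<open>Every set element comes from a formula, so the set that an axiom demands is the truth
  set of the compound formula \<open>c \<phi> \<psi>\<close>.\<close>

lemma fosat_comprehension_axiom:
  assumes y: "y \<in> Nd" "asg y g"
    and \<chi>: "\<And>\<phi> \<psi> y' h t v. y' \<in> Nd \<Longrightarrow> asg y' h \<Longrightarrow> h 0 = es (truth_set M \<phi>) \<Longrightarrow>
      h 1 = es (truth_set M \<psi>) \<Longrightarrow> h 3 = eo t \<Longrightarrow> F y' t = Some v \<Longrightarrow>
      fosat K \<chi> y' h \<longleftrightarrow> sat M (c \<phi> \<psi>) v"
  shows "fosat K (FAll 0 (FAll 1 ((SetA 0 \<^bold>\<and> SetA 1) \<^bold>\<longrightarrow>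
      FEx 2 (SetA 2 \<^bold>\<and> FAllO 3 (ElemA 3 2 \<^bold>\<longleftrightarrow> \<chi>))))) y g"
proof (intro fosat_FAll_I fosat_FImp_I)
  fix y1 a y2 b y3
  let ?g = "g(0 := a, 1 := b)"
  assume y3: "y3 \<in> Nd" "asg y3 ?g" "fosat K (SetA 0 \<^bold>\<and> SetA 1) y3 ?g"
  then obtain \<phi> \<psi> where ab: "a = es (truth_set M \<phi>)" "b = es (truth_set M \<psi>)"
    by (auto simp: K_simps)
  let ?X = "truth_set M (c \<phi> \<psi>)"
  let ?h = "?g(2 := es ?X)"
  have h: "asg y3 ?h" using y3(2) es_dom by (rule asg_upd)
  have "fosat K (FAllO 3 (ElemA 3 2 \<^bold>\<longleftrightarrow> \<chi>)) y3 ?h \<longleftrightarrow> ?X = ?X"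
  proof (rule fosat_comprehension_iff[OF y3(1) h])
    fix y4 t v assume y4: "(y3, y4) \<in> ord K" "F y4 t = Some v"
    have n: "y4 \<in> Nd" and "eo t \<in> dom (str K y4)" using y4 unfolding K_simps by blast+
    then have "asg y4 (?h(3 := eo t))" using asg_hom[OF h y4(1)] asg_upd by simp
    from \<chi>[OF n this _ _ _ y4(2), of \<phi> \<psi>]
    show "fosat K \<chi> y4 (?h(3 := eo t)) \<longleftrightarrow> v \<in> ?X"
      using ab F_worlds[OF n y4(2)] by simp
  qed auto
  moreover have "fosat K (SetA 2) y3 ?h" unfolding fosat.simps K_simps by auto
  ultimately have "fosat K (SetA 2 \<^bold>\<and> FAllO 3 (ElemA 3 2 \<^bold>\<longleftrightarrow> \<chi>)) y3 ?h"
    by (simp only: fosat.simps(9))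
  then show "fosat K (FEx 2 (SetA 2 \<^bold>\<and> FAllO 3 (ElemA 3 2 \<^bold>\<longleftrightarrow> \<chi>))) y3 ?g"
    by (rule fosat_FEx_I[OF es_dom])
qed (use y in \<open>auto simp: asg_upd\<close>)

lemma elemI_truth_set:
  "y \<in> Nd \<Longrightarrow> F y t = Some v \<Longrightarrow> (eo t, es (truth_set M \<phi>)) \<in> elemI (str K y) \<longleftrightarrow> sat M \<phi> v"
  using K_elemI[OF rangeI] F_worlds by blast

lemma elemI_eo: "(a, b) \<in> elemI (str K y) \<Longrightarrow> \<exists>t v. a = eo t \<and> F y t = Some v"
  unfolding K_simps by blast

lemma Th_K:
  assumes y: "y \<in> Nd" "asg y g" and \<phi>: "\<phi> \<in> Th"
  shows "fosat K \<phi> y g"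
proof -
  have sorts: "fosat K (FAll 0 (SetA 0 \<^bold>\<or> ObjA 0)) y g"
    by (rule fosat_FAll_I) (use y in \<open>auto simp: K_simps(3)\<close>)
  have disjoint: "fosat K (FAll 0 (\<^bold>\<not> (SetA 0 \<^bold>\<and> ObjA 0))) y g"
    by (intro fosat_FAll_I fosat_FImp_I y; unfold fosat.simps K_simps) (use eo_neq_es in auto)
  have pred: "fosat K (FAll 0 (PredA p 0 \<^bold>\<longrightarrow> ObjA 0)) y g" for p
    by (intro fosat_FAll_I fosat_FImp_I y; unfold fosat.simps K_simps) auto
  have elem: "fosat K (FAll 0 (FAll 1 (ElemA 0 1 \<^bold>\<longrightarrow> (ObjA 0 \<^bold>\<and> SetA 1)))) y g"
    by (intro fosat_FAll_I fosat_FImp_I y; unfold fosat.simps K_simps) auto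
  have rel: "fosat K (FAll 0 (FAll 1 (FAll 2 (RelA 0 1 2 \<^bold>\<longrightarrow> (ObjA 0 \<^bold>\<and> SetA 1 \<^bold>\<and> ObjA 2))))) y g"
    by (intro fosat_FAll_I fosat_FImp_I) (use y in \<open>auto dest: relI_objI\<close>)
  have var: "fosat K (FEx 0 (SetA 0 \<^bold>\<and> FAll 1 (ElemA 1 0 \<^bold>\<longleftrightarrow> PredA p 1))) y g" for p
  proof -
    let ?g = "g(0 := es (truth_set M (Var p)))"
    \<comment> \<open>The axiom for variables quantifies over all individuals. If \<open>a\<close>
      is a set element, both sides are false, as each of them forces \<open>a\<close> to be an
      object.\<close>
    have iff: "(a, es (truth_set M (Var p))) \<in> elemI (str K y') \<longleftrightarrow> a \<in> predI (str K y') p"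
      if "y' \<in> Nd" for a y'
    proof
      assume a: "(a, es (truth_set M (Var p))) \<in> elemI (str K y')"
      then obtain t v where "a = eo t" "F y' t = Some v" using elemI_eo by blast
      then show "a \<in> predI (str K y') p"
        using a elemI_truth_set[OF that, of t v "Var p"] by (simp add: K_predI)
    next
      assume "a \<in> predI (str K y') p"
      then obtain t v where "a = eo t" "F y' t = Some v" "v \<in> val M p" unfolding K_simps by blast
      then show "(a, es (truth_set M (Var p))) \<in> elemI (str K y')"
        using elemI_truth_set[OF that, of t v "Var p"] by simp
    qed
    have "asg y ?g" using y(2) es_dom by (rule asg_upd)
    then have "fosat K (FAll 1 (ElemA 1 0 \<^bold>\<longleftrightarrow> PredA p 1)) y ?g"
      unfolding fosat.simps(7,3,9,11,12) hom_K by (auto simp: K_simps(2) iff simp del: sat.simps)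
    then show ?thesis
      by (intro fosat_FEx_I[OF es_dom[of "Var p"]]) (simp add: es_setI del: fosat.simps(12) sat.simps)
  qed
  have top: "fosat K (FEx 0 (SetA 0 \<^bold>\<and> FAllO 1 (ElemA 1 0))) y g"
  proof -
    have "(a, es (truth_set M Top)) \<in> elemI (str K y')" if n: "y' \<in> Nd" and a: "a \<in> objI (str K y')" for a y'
    proof -
      obtain t v where "a = eo t" "F y' t = Some v" using a unfolding K_simps by blast
      then show ?thesis using elemI_truth_set[OF n, of t v Top] by simp
    qed
    then have "fosat K (FAllO 1 (ElemA 1 0)) y (g(0 := es (truth_set M Top)))"
      by (simp add: K_simps(2) del: sat.simps)
    then show ?thesis
      by (intro fosat_FEx_I[OF es_dom[of Top]]) (simp add: es_setI del: fosat.simps(12) sat.simps)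
  qed
  have bot: "fosat K (FEx 0 (SetA 0 \<^bold>\<and> FAll 1 (\<^bold>\<not> (ElemA 1 0)))) y g"
  proof -
    have "(a, es (truth_set M Bot)) \<notin> elemI (str K y')" if "y' \<in> Nd" for a y'
      using elemI_eo elemI_truth_set[OF that, of _ _ Bot] by fastforce
    then have "fosat K (FAll 1 (\<^bold>\<not> (ElemA 1 0))) y (g(0 := es (truth_set M Bot)))"
      by (simp add: K_simps(2) del: sat.simps)
    then show ?thesis
      by (intro fosat_FEx_I[OF es_dom[of Bot]]) (simp add: es_setI del: fosat.simps(12) sat.simps)
  qed
  have conn: "fosat K (FAll 0 (FAll 1 ((SetA 0 \<^bold>\<and> SetA 1) \<^bold>\<longrightarrow>
      FEx 2 (SetA 2 \<^bold>\<and> FAllO 3 (ElemA 3 2 \<^bold>\<longleftrightarrow> c (ElemA 3 0) (ElemA 3 1)))))) y g"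
    if "c \<in> {FAnd, FOr, FImp}" for c
  proof -
    consider "c = FAnd" | "c = FOr" | "c = FImp" using \<open>c \<in> _\<close> by blast
    then show ?thesis
    proof cases
      case 1
      show ?thesis
        unfolding 1 by (rule fosat_comprehension_axiom[OF y, where c = Conj]) (simp add: elemI_truth_set)
    next
      case 2
      show ?thesis
        unfolding 2 by (rule fosat_comprehension_axiom[OF y, where c = Disj]) (simp add: elemI_truth_set)
    next
      case 3
      show ?thesis
        unfolding 3
      proof (rule fosat_comprehension_axiom[OF y, where c = Impl])
        fix \<phi> \<psi> y' h t v
        assume h: "y' \<in> Nd" "asg y' h" "h 0 = es (truth_set M \<phi>)" "h 1 = es (truth_set M \<psi>)"
          "h 3 = eo t" "F y' t = Some v"
        show "fosat K (ElemA 3 0 \<^bold>\<longrightarrow> ElemA 3 1) y' h \<longleftrightarrow> sat M (Impl \<phi> \<psi>) v"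
          unfolding fosat.simps hom_K h
          by (rule sat_Impl_iff[OF h(1,6)]) (simp_all only: elemI_truth_set K_simps(2))
      qed
    qed
  qed
  have box: "fosat K (FAll 0 (FAll 1 ((SetA 0 \<^bold>\<and> SetA 1) \<^bold>\<longrightarrow> FEx 2 (SetA 2 \<^bold>\<and>
      FAllO 3 (ElemA 3 2 \<^bold>\<longleftrightarrow> FAll 4 (RelA 3 0 4 \<^bold>\<longrightarrow> ElemA 4 1)))))) y g"
  proof (rule fosat_comprehension_axiom[OF y, where c = BoxTo])
    fix \<phi> \<psi> y' h t v
    assume h: "y' \<in> Nd" "asg y' h" "h 0 = es (truth_set M \<phi>)" "h 1 = es (truth_set M \<psi>)"
      "h 3 = eo t" "F y' t = Some v"
    have "fosat K (FAll 4 (RelA 3 0 4 \<^bold>\<longrightarrow> ElemA 4 1)) y' h \<longleftrightarrow> (\<forall>y''. (y', y'') \<in> ord K \<longrightarrow>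
      (\<forall>b\<in>dom (str K y''). (eo t, es (truth_set M \<phi>), b) \<in> relI (str K y'') \<longrightarrow>
        (b, es (truth_set M \<psi>)) \<in> elemI (str K y'')))"
      unfolding FAll_FImp_iff[OF h(2)] using h by simp
    also have "\<dots> \<longleftrightarrow> sat M (BoxTo \<phi> \<psi>) v"
      by (rule sat_BoxTo_iff[OF h(1,6)]) (simp only: elemI_truth_set K_simps(2))
    finally show "fosat K (FAll 4 (RelA 3 0 4 \<^bold>\<longrightarrow> ElemA 4 1)) y' h \<longleftrightarrow> sat M (BoxTo \<phi> \<psi>) v" .
  qed
  have dia: "fosat K (FAll 0 (FAll 1 ((SetA 0 \<^bold>\<and> SetA 1) \<^bold>\<longrightarrow> FEx 2 (SetA 2 \<^bold>\<and>
      FAllO 3 (ElemA 3 2 \<^bold>\<longleftrightarrow> FEx 4 (RelA 3 0 4 \<^bold>\<and> ElemA 4 1)))))) y g"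
  proof (rule fosat_comprehension_axiom[OF y, where c = DiaTo])
    fix \<phi> \<psi> y' h t v
    assume h: "y' \<in> Nd" "asg y' h" "h 0 = es (truth_set M \<phi>)" "h 1 = es (truth_set M \<psi>)"
      "h 3 = eo t" "F y' t = Some v"
    have "fosat K (FEx 4 (RelA 3 0 4 \<^bold>\<and> ElemA 4 1)) y' h \<longleftrightarrow> (\<exists>b\<in>dom (str K y').
        (eo t, es (truth_set M \<phi>), b) \<in> relI (str K y') \<and>
        (b, es (truth_set M \<psi>)) \<in> elemI (str K y'))"
      using h by simp
    also have "\<dots> \<longleftrightarrow> sat M (DiaTo \<phi> \<psi>) v"
      by (rule sat_DiaTo_iff[OF h(1,6)]) (simp only: elemI_truth_set h(1))
    finally show "fosat K (FEx 4 (RelA 3 0 4 \<^bold>\<and> ElemA 4 1)) y' h \<longleftrightarrow> sat M (DiaTo \<phi> \<psi>) v" .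
  qed
  have ext: "fosat K (FAll 0 (FAll 1 ((SetA 0 \<^bold>\<and> SetA 1 \<^bold>\<and> FAllO 2 (ElemA 2 0 \<^bold>\<longleftrightarrow> ElemA 2 1)) \<^bold>\<longrightarrow>
      0 \<^bold>\<equiv> 1))) y g"
  proof (intro fosat_FAll_I fosat_FImp_I)
    fix y1 a y2 b y3
    let ?g = "g(0 := a, 1 := b)"
    assume y3: "y3 \<in> Nd" "asg y3 ?g"
      and "fosat K (SetA 0 \<^bold>\<and> SetA 1 \<^bold>\<and> FAllO 2 (ElemA 2 0 \<^bold>\<longleftrightarrow> ElemA 2 1)) y3 ?g"
    then have eq: "fosat K (FAllO 2 (ElemA 2 0 \<^bold>\<longleftrightarrow> ElemA 2 1)) y3 ?g"
      and "a \<in> setI (str K y3)" "b \<in> setI (str K y3)"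
      by (simp_all only: fosat.simps(6,9) fun_upd_same fun_upd_other zero_neq_one simp_thms)
    then obtain X \<psi> where ab: "X \<in> D" "a = es X" "b = es (truth_set M \<psi>)"
      unfolding K_simps by blast
    \<comment> \<open>Membership in the second set is itself taken as the defining condition, so
      uniqueness of the comprehended set identifies the two.\<close>
    have "fosat K (FAllO 2 (ElemA 2 0 \<^bold>\<longleftrightarrow> ElemA 2 1)) y3 ?g \<longleftrightarrow> X = truth_set M \<psi>"
      by (rule fosat_comprehension_iff[OF y3]) (use ab in \<open>auto simp: K_elemI\<close>)
    then show "fosat K (0 \<^bold>\<equiv> 1) y3 ?g" using eq ab by simp
  qed (use y in \<open>auto simp: asg_upd\<close>)
  show ?thesis
    using \<phi> unfolding Th_def Let_def
    by (elim UnE insertE emptyE rangeE imageE; hypsubst)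
      (rule sorts disjoint pred elem rel var top bot conn box dia ext; simp)+
qed

end

section \<open>Placements of trees and their growth\<close>

context chellas
begin

text \<open>
  Objects are paths of labelled steps, listed from their end. A step \<open>(\<phi>, m, u)\<close> is a successor
  for \<open>\<phi>\<close>; it was introduced at stage \<open>m\<close>, at the world \<open>u\<close>. The empty path is not an object.
\<close>

definition placement :: "nat \<Rightarrow> ((fm \<times> nat \<times> 'w) list \<Rightarrow> 'w option) \<Rightarrow> bool" where
  "placement n F \<longleftrightarrow> F [] = None \<and> (\<forall>\<phi> m u q v. F ((\<phi>, m, u) # q) = Some v \<longrightarrow>
     m < n \<and> v \<in> worlds M \<and>
     (q \<noteq> [] \<longrightarrow> (\<exists>v0. F q = Some v0 \<and> (v0, truth_set M \<phi>, v) \<in> acc M)))"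

lemma placementD:
  assumes "placement n F" "F t = Some v"
  obtains \<phi> m u q where "t = (\<phi>, m, u) # q" "m < n" "v \<in> worlds M"
    "q \<noteq> [] \<Longrightarrow> \<exists>v0. F q = Some v0 \<and> (v0, truth_set M \<phi>, v) \<in> acc M"
proof -
  obtain \<phi> m u q where t: "t = (\<phi>, m, u) # q"
    using assms by (cases t) (auto simp: placement_def)
  have *: "m < n \<and> v \<in> worlds M \<and>
      (q \<noteq> [] \<longrightarrow> (\<exists>v0. F q = Some v0 \<and> (v0, truth_set M \<phi>, v) \<in> acc M))"
    using assms(1) assms(2)[unfolded t] unfolding placement_def by blast
  show ?thesis by (rule that[OF t]) (use * in blast)+
qed

text \<open>
  A partial map \<open>A\<close> that moves an object of \<open>F\<close> upwards together with its ancestors.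
\<close>

definition raising :: "((fm \<times> nat \<times> 'w) list \<Rightarrow> 'w option) \<Rightarrow> ((fm \<times> nat \<times> 'w) list \<Rightarrow> 'w option) \<Rightarrow> bool" where
  "raising F A \<longleftrightarrow> (\<forall>t w. A t = Some w \<longrightarrow> (\<exists>v. F t = Some v \<and> (v, w) \<in> le M)) \<and>
    (\<forall>\<phi> m u q w. A ((\<phi>, m, u) # q) = Some w \<longrightarrow> q \<noteq> [] \<longrightarrow>
      (\<exists>v0. A q = Some v0 \<and> (v0, truth_set M \<phi>, w) \<in> acc M))"

lemma raising_old: "raising F A \<Longrightarrow> A t = Some w \<Longrightarrow> \<exists>v. F t = Some v \<and> (v, w) \<in> le M"
  by (simp add: raising_def)

lemma raising_pred: "raising F A \<Longrightarrow> A ((\<phi>, m, u) # q) = Some w \<Longrightarrow> q \<noteq> [] \<Longrightarrow>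
    \<exists>v0. A q = Some v0 \<and> (v0, truth_set M \<phi>, w) \<in> acc M"
  unfolding raising_def by blast

text \<open>By (c2), moving the end of a step forces its start upwards, and the chain stops at a
  one-step path. The length bound ensures that no path moved so far has \<open>l # q\<close> as its
  predecessor, so adding \<open>l # q\<close> disturbs no earlier edge.\<close>

lemma raising_exists:
  assumes F: "placement n F"
  shows "F t = Some v \<Longrightarrow> (v, w) \<in> le M \<Longrightarrow>
    \<exists>A. raising F A \<and> A t = Some w \<and> (\<forall>s. A s \<noteq> None \<longrightarrow> length s \<le> length t)"
proof (induction t arbitrary: v w)
  case Nil
  then show ?case using F by (simp add: placement_def)
next
  case (Cons l q)
  obtain \<phi> m u where l: "l = (\<phi>, m, u)" by (cases l)
  show ?case
  proof (cases "q = []")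
    case True
    let ?A = "(\<lambda>_. None)(l # q := Some w)"
    have "raising F ?A"
      using Cons.prems True by (auto simp: raising_def)
    then show ?thesis by (rule exI[of _ ?A, OF conjI]) simp
  next
    case False
    then obtain v0 where v0: "F q = Some v0" "(v0, truth_set M \<phi>, v) \<in> acc M"
      using placementD[OF F Cons.prems(1)] l by blast
    obtain w0 where w0: "(v0, w0) \<in> le M" "(w0, truth_set M \<phi>, w) \<in> acc M"
      using v0(2) Cons.prems(2) by (rule acc_down)
    obtain A where A: "raising F A" "A q = Some w0" "\<forall>s. A s \<noteq> None \<longrightarrow> length s \<le> length q"
      using Cons.IH[OF v0(1) w0(1)] by blast
    let ?A = "A(l # q := Some w)"
    have "raising F ?A"
      unfolding raising_def
    proof (intro conjI allI impI)
      show "\<exists>v. F s = Some v \<and> (v, a) \<in> le M" if "?A s = Some a" for s a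
        using that A(1) Cons.prems by (auto simp: raising_def split: if_splits)
      show "\<exists>v0. ?A p = Some v0 \<and> (v0, truth_set M \<psi>, a) \<in> acc M"
        if p: "?A ((\<psi>, k, x) # p) = Some a" "p \<noteq> []" for \<psi> k x p a
      proof (cases "(\<psi>, k, x) # p = l # q")
        case True
        then show ?thesis using p l A(2) w0(2) by auto
      next
        case False
        then have a: "A ((\<psi>, k, x) # p) = Some a" using p by (auto split: if_splits)
        then have "Suc (length p) \<le> length q" using A(3)[rule_format, of "(\<psi>, k, x) # p"] by simp
        then have "p \<noteq> l # q" by auto
        moreover obtain v0 where "A p = Some v0" "(v0, truth_set M \<psi>, a) \<in> acc M"
          using raising_pred[OF A(1) a p(2)] by blast
        ultimately show ?thesis by auto
      qed
    qed
    moreover have "length s \<le> length (l # q)" if "?A s \<noteq> None" for s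
      using that A(3)[rule_format, of s] by (auto split: if_splits)
    moreover have "?A (l # q) = Some w" by simp
    ultimately show ?thesis by blast
  qed
qed

text \<open>
  Objects not moved by \<open>A\<close> follow their predecessor, and fresh labels of stage \<open>n\<close> supply all
  missing successors.
\<close>

primrec grow :: "nat \<Rightarrow> ((fm \<times> nat \<times> 'w) list \<Rightarrow> 'w option) \<Rightarrow> ((fm \<times> nat \<times> 'w) list \<Rightarrow> 'w option) \<Rightarrow>
    (fm \<times> nat \<times> 'w) list \<Rightarrow> 'w option" where
  "grow n F A [] = None"
| "grow n F A (l # q) = (case A (l # q) of Some w \<Rightarrow> Some w | None \<Rightarrow>
     (case F (l # q) of
       Some v \<Rightarrow> if q = [] then Some v
         else Some (SOME v'. (v, v') \<in> le M \<and> (the (grow n F A q), truth_set M (fst l), v') \<in> acc M)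
     | None \<Rightarrow> (case l of (\<phi>, m, u) \<Rightarrow> if m = n \<and> u \<in> worlds M \<and>
         (q = [] \<or> (\<exists>v. grow n F A q = Some v \<and> (v, truth_set M \<phi>, u) \<in> acc M))
         then Some u else None)))"

context
  fixes n F A assumes F: "placement n F" and A: "raising F A"
begin

lemma grow_raised: "A t = Some w \<Longrightarrow> grow n F A t = Some w"
  using raising_old[OF A] F by (cases t) (fastforce simp: placement_def)+

text \<open>The upward move and the edge to the predecessor come from the same choice of
  \<open>v'\<close>, hence one induction. For a raised object the edge is kept because its ancestors
  are raised with it.\<close>

lemma grow_old:
  "F t = Some v \<Longrightarrow> \<exists>v'. grow n F A t = Some v' \<and> (v, v') \<in> le M \<and>
    (\<forall>\<phi> m u q. t = (\<phi>, m, u) # q \<longrightarrow> q \<noteq> [] \<longrightarrow>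
      (\<exists>v0. grow n F A q = Some v0 \<and> (v0, truth_set M \<phi>, v') \<in> acc M))"
proof (induction t arbitrary: v)
  case Nil
  then show ?case using F by (simp add: placement_def)
next
  case (Cons l q)
  obtain \<phi> m u where l: "l = (\<phi>, m, u)" by (cases l)
  have v: "v \<in> worlds M" using F Cons.prems by (rule placementD)
  show ?case
  proof (cases "A (l # q)")
    case None
    show ?thesis
    proof (cases "q = []")
      case True
      then show ?thesis using None Cons.prems le_refl[OF v] by simp
    next
      case False
      then obtain v0 where v0: "F q = Some v0" "(v0, truth_set M \<phi>, v) \<in> acc M"
        using placementD[OF F Cons.prems] l by blast
      obtain v1 where v1: "grow n F A q = Some v1" "(v0, v1) \<in> le M"
        using Cons.IH[OF v0(1)] by blast
      \<comment> \<open>The predecessor has moved from \<open>v0\<close> up to \<open>v1\<close>, so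
        (c1) yields a matching move of \<open>v\<close>. The predecessor is placed by
        \<open>grow\<close>, so \<open>the\<close> in its definition returns
        \<open>v1\<close>.\<close>
      let ?P = "\<lambda>v'. (v, v') \<in> le M \<and> (v1, truth_set M \<phi>, v') \<in> acc M"
      have "\<exists>v'. ?P v'" using acc_up[OF v1(2) v0(2)] by blast
      then have "?P (SOME v'. ?P v')" by (rule someI_ex)
      moreover have "grow n F A (l # q) = Some (SOME v'. ?P v')"
        using None False Cons.prems v1 l by simp
      ultimately show ?thesis using l v1 by simp
    qed
  next
    case (Some w)
    then have "(v, w) \<in> le M" using raising_old[OF A] Cons.prems by fastforce
    moreover have "\<exists>v0. grow n F A q = Some v0 \<and> (v0, truth_set M \<phi>, w) \<in> acc M" if "q \<noteq> []"
      using raising_pred[OF A Some[unfolded l] that] grow_raised by blast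
    ultimately show ?thesis using grow_raised[OF Some] l by simp
  qed
qed

lemma below_grow: "below M F (grow n F A)"
  unfolding below_def using grow_old by blast

lemma F_stage: "F ((\<phi>, n, u) # q) = None" "A ((\<phi>, n, u) # q) = None"
proof -
  show *: "F ((\<phi>, n, u) # q) = None"
  proof (rule ccontr)
    assume "F ((\<phi>, n, u) # q) \<noteq> None"
    then obtain v where "F ((\<phi>, n, u) # q) = Some v" by blast
    from placementD[OF F this] show False by fastforce
  qed
  show "A ((\<phi>, n, u) # q) = None"
    using raising_old[OF A] * by (cases "A ((\<phi>, n, u) # q)") fastforce+
qed

lemma grow_fresh:
  "u \<in> worlds M \<Longrightarrow> q = [] \<or> (\<exists>v. grow n F A q = Some v \<and> (v, truth_set M \<phi>, u) \<in> acc M) \<Longrightarrow>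
    grow n F A ((\<phi>, n, u) # q) = Some u"
  by (simp add: F_stage)

lemma placement_grow: "placement (Suc n) (grow n F A)"
  unfolding placement_def
proof (intro conjI allI impI)
  fix \<phi> m u q v assume G: "grow n F A ((\<phi>, m, u) # q) = Some v"
  have "m < Suc n \<and> v \<in> worlds M \<and>
      (q \<noteq> [] \<longrightarrow> (\<exists>v0. grow n F A q = Some v0 \<and> (v0, truth_set M \<phi>, v) \<in> acc M))"
  proof (cases "F ((\<phi>, m, u) # q)")
    case None
    \<comment> \<open>A raising map touches old objects only, so a path not placed by
      \<open>F\<close> can enter through the fresh branch alone, with \<open>m = n\<close>.\<close>
    then have "A ((\<phi>, m, u) # q) = None"
      using raising_old[OF A] by (cases "A ((\<phi>, m, u) # q)") fastforce+
    with None G show ?thesis by (auto split: if_splits)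
  next
    case (Some v0)
    then have "m < n" using F by (auto simp: placement_def)
    moreover have "(v0, v) \<in> le M"
      "q \<noteq> [] \<longrightarrow> (\<exists>v0. grow n F A q = Some v0 \<and> (v0, truth_set M \<phi>, v) \<in> acc M)"
      using grow_old[OF Some] G by (simp_all del: grow.simps(2))
    ultimately show ?thesis using le_worlds by auto
  qed
  then show "m < Suc n" "v \<in> worlds M"
    "q \<noteq> [] \<Longrightarrow> \<exists>v0. grow n F A q = Some v0 \<and> (v0, truth_set M \<phi>, v) \<in> acc M"
    by blast+
qed simp

end

definition full :: "((fm \<times> nat \<times> 'w) list \<Rightarrow> 'w option) \<Rightarrow> bool" where
  "full F \<longleftrightarrow> (\<forall>q u \<phi> v. F q = Some u \<and> (u, truth_set M \<phi>, v) \<in> acc M \<longrightarrow>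
      (\<exists>m w. F ((\<phi>, m, w) # q) = Some v)) \<and>
    (\<forall>w\<in>worlds M. \<exists>t. F t = Some w)"

text \<open>One growth step saturates completely: the recursion runs along paths of any length, so
  fresh objects receive fresh successors of the same stage. The world in a label tells apart the
  successors added to one object for one formula.\<close>

lemma full_grow: "placement n F \<Longrightarrow> raising F A \<Longrightarrow> full (grow n F A)"
  unfolding full_def
proof (intro conjI allI impI ballI; (elim conjE)?)
  assume F: "placement n F" and A: "raising F A"
  note fresh = grow_fresh[OF F A]
  show "\<exists>m w. grow n F A ((\<phi>, m, w) # q) = Some v"
    if "grow n F A q = Some u" "(u, truth_set M \<phi>, v) \<in> acc M" for q u \<phi> v
    using fresh[of v q \<phi>] acc_worlds that by blast
  show "\<exists>t. grow n F A t = Some w" if "w \<in> worlds M" for w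
    using fresh[OF that, of "[]"] by blast
qed

text \<open>The bound on stages leaves fresh labels for the next growth, so a node can be extended
  again and again.\<close>

definition nodes_of :: "((fm \<times> nat \<times> 'w) list \<Rightarrow> 'w option) set" where
  "nodes_of = {F. full F \<and> (\<exists>n. placement n F)}"

lemma nodes_of_nonempty: "nodes_of \<noteq> {}"
proof -
  have "placement 0 (\<lambda>_. None)" "raising (\<lambda>_. None) (\<lambda>_. None)"
    by (simp_all add: placement_def raising_def)
  from placement_grow[OF this] full_grow[OF this] show ?thesis
    unfolding nodes_of_def by blast
qed

lemma nodes_of_extend:
  assumes "F \<in> nodes_of" "F t = Some v" "(v, w) \<in> le M"
  shows "\<exists>G\<in>nodes_of. below M F G \<and> G t = Some w"
proof -
  obtain n where F: "placement n F" using assms(1) by (auto simp: nodes_of_def)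
  obtain A where A: "raising F A" "A t = Some w"
    using raising_exists[OF F assms(2,3)] by blast
  show ?thesis
    using placement_grow[OF F A(1)] full_grow[OF F A(1)] below_grow[OF F A(1)] grow_raised[OF F A]
    by (intro bexI[of _ "grow n F A"]) (auto simp: nodes_of_def)
qed

end

section \<open>Passing to countably many nodes\<close>

text \<open>With countably many worlds there are countably many paths and formulas, hence
  individuals. Among the requirements of \<open>saturated_system\<close> only \<open>extend\<close>
  asks for further nodes; closing under it, with one demand for each object and target world, gives
  a countable \<open>B\<close>. The others, apart from nonemptiness, concern the codings or single
  nodes.\<close>

lemma sheaf_of_chellas:
  fixes M :: "'w::countable chellas"
  assumes M: "chellas_model M" and w: "w \<in> worlds M"
  obtains K :: "('v::infinite, 'a::infinite) sheaf" and y g where "kripke_sheaf K" "y \<in> nodes K"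
    "\<forall>x. g x \<in> dom (str K y)" "\<forall>\<phi>\<in>Th. fosat K \<phi> y g"
    "\<forall>x \<phi>. fosat K (ST x \<phi>) y g \<longleftrightarrow> sat M \<phi> w"
proof -
  interpret chellas M by unfold_locales (rule M)
  obtain F0 where F0: "F0 \<in> nodes_of" using nodes_of_nonempty by blast
  define Q where "Q = (\<lambda>(t :: (fm \<times> nat \<times> 'w) list, w) F (_ :: (fm \<times> nat \<times> 'w) list \<Rightarrow> 'w option)
    (_ :: (fm \<times> nat \<times> 'w) list \<Rightarrow> 'w option) G. below M F G \<and> G t = Some w)"
  have "countable {F0}" "{F0} \<subseteq> nodes_of" using F0 by auto
  then obtain B where B: "countable B" "{F0} \<subseteq> B" "B \<subseteq> nodes_of"
    and closed: "\<forall>i. \<forall>a\<in>B. \<forall>b\<in>B. \<forall>c\<in>B. \<forall>d\<in>nodes_of. Q i a b c d \<longrightarrow> (\<exists>d\<in>B. Q i a b c d)"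
    by (rule countable_closure[where Q = Q])
  obtain e :: "((fm \<times> nat \<times> 'w) list \<Rightarrow> 'w option) \<Rightarrow> 'v" where e: "inj_on e B"
    using B(1) by (rule countable_inj_on)
  have "countable (UNIV :: ((fm \<times> nat \<times> 'w) list + fm) set)" by simp
  then obtain h :: "(fm \<times> nat \<times> 'w) list + fm \<Rightarrow> 'a" where h: "inj h"
    by (rule countable_inj_on)
  define dec where "dec = inv_into B e"
  \<comment> \<open>A truth set is encoded through a chosen formula defining it, since the subsets
    of \<open>'w\<close> may be uncountable while formulas are not.\<close>
  define code where "code X = (SOME \<phi>. truth_set M \<phi> = X)" for X
  define es where "es X = h (Inr (code X))" for X
  have code: "truth_set M (code X) = X" if "X \<in> range (truth_set M)" for X
    unfolding code_def by (rule someI_ex) (use that in blast)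
  have dec: "dec (e F) = F" if "F \<in> B" for F
    using e that by (simp add: dec_def)
  \<comment> \<open>The condition \<open>s \<noteq> []\<close> makes one-step paths roots: they
    would otherwise count as successors of the empty path, which is placed nowhere.\<close>
  interpret S: saturated_system M "e ` B" dec
    "\<lambda>s \<phi> t. s \<noteq> [] \<and> (\<exists>m u. t = (\<phi>, m, u) # s)" "h \<circ> Inl" es
  proof
    show "inj (h \<circ> Inl)" using h by (intro inj_compose) simp_all
    show "inj_on es (range (truth_set M))"
    proof (rule inj_onI)
      fix X Y assume X: "X \<in> range (truth_set M)" and Y: "Y \<in> range (truth_set M)"
        and eq: "es X = es Y"
      have "code X = code Y" using injD[OF h eq[unfolded es_def]] by (rule Inr_inject)
      then have "truth_set M (code X) = truth_set M (code Y)" by (rule arg_cong)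
      then show "X = Y" unfolding code[OF X] code[OF Y] .
    qed
    show "(h \<circ> Inl) t \<noteq> es (truth_set M \<phi>)" for t \<phi>
      using h by (simp add: es_def inj_eq)
    show "e ` B \<noteq> {}" using B(2) by blast
    fix y assume "y \<in> e ` B"
    then obtain F where F: "y = e F" "F \<in> B" "dec y = F" using dec by blast
    have full: "full F" and "\<exists>n. placement n F" using B(3) F(2) by (auto simp: nodes_of_def)
    then obtain n where n: "placement n F" by blast
    show "v \<in> worlds M" if "dec y t = Some v" for t v
      using n that unfolding F(3) by (rule placementD)
    show "\<exists>u. dec y s = Some u \<and> (u, truth_set M \<phi>, v) \<in> acc M"
      if "s \<noteq> [] \<and> (\<exists>m u. t = (\<phi>, m, u) # s)" "dec y t = Some v" for s \<phi> t v
      using n that unfolding F(3) placement_def by blast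
    show "\<exists>t. (s \<noteq> [] \<and> (\<exists>m u. t = (\<phi>, m, u) # s)) \<and> dec y t = Some v"
      if s: "dec y s = Some u" and acc: "(u, truth_set M \<phi>, v) \<in> acc M" for s u \<phi> v
    proof -
      have "s \<noteq> []" using n s unfolding F(3) placement_def by auto
      moreover obtain m w where "F ((\<phi>, m, w) # s) = Some v"
        using full s acc unfolding F(3) full_def by blast
      ultimately show ?thesis unfolding F(3) by blast
    qed
    show "\<exists>t. dec y t = Some w" if "w \<in> worlds M" for w
      using full that unfolding F(3) full_def by blast
    show "\<exists>y'\<in>e ` B. below M (dec y) (dec y') \<and> dec y' t = Some w"
      if t: "dec y t = Some v" and le: "(v, w) \<in> le M" for t v w
    proof -
      have "F \<in> nodes_of" "F t = Some v" using B(3) F t by auto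
      from nodes_of_extend[OF this le]
      obtain G where G: "G \<in> nodes_of" "below M F G" "G t = Some w" by blast
      have "Q (t, w) F F F G" using G(2,3) by (simp add: Q_def)
      with closed F(2) G(1) have "\<exists>G\<in>B. Q (t, w) F F F G" by blast
      then obtain G where "G \<in> B" "below M F G" "G t = Some w" unfolding Q_def by auto
      then show ?thesis using F(3) dec by auto
    qed
  qed
  have y: "e F0 \<in> e ` B" using B(2) by blast
  obtain t where t: "dec (e F0) t = Some w" using S.inhabited[OF y w] by blast
  \<comment> \<open>A constant assignment makes every variable denote an object at \<open>w\<close>,
    which settles all \<open>x\<close> together.\<close>
  let ?g = "\<lambda>_. h (Inl t)"
  have g: "?g x \<in> dom (str S.K (e F0))" for x
    unfolding S.K_simps using t by auto
  then have asg: "S.asg (e F0) ?g" by (simp add: S.asg_def)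
  show ?thesis
  proof (rule that)
    show "kripke_sheaf S.K" by (rule S.kripke_sheaf_K)
    show "e F0 \<in> nodes S.K" using y by (simp add: S.K_simps)
    show "\<forall>x. ?g x \<in> dom (str S.K (e F0))" using g by blast
    show "\<forall>\<phi>\<in>Th. fosat S.K \<phi> (e F0) ?g" using S.Th_K[OF y asg] by blast
    show "\<forall>x \<phi>. fosat S.K (ST x \<phi>) (e F0) ?g \<longleftrightarrow> sat M \<phi> w"
      using S.fosat_ST[OF y asg _ t] by simp
  qed
qed

section \<open>Faithfulness of the standard translation\<close>

theorem theorem2:
  fixes \<Gamma> \<Delta> :: "fm set" and x :: ivar
  shows "chellas_entails TYPE('w::infinite) \<Gamma> \<Delta> \<longleftrightarrow>
         fo_entails TYPE('v::infinite) TYPE('a::infinite) (Th \<union> ST x ` \<Gamma>) (ST x ` \<Delta>)"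
proof
  assume chellas: "chellas_entails TYPE('w) \<Gamma> \<Delta>"
  show "fo_entails TYPE('v) TYPE('a) (Th \<union> ST x ` \<Gamma>) (ST x ` \<Delta>)"
    unfolding fo_entails_def
  proof (intro notI; elim exE conjE)
    fix K :: "('v, 'a) sheaf" and v f
    assume K: "kripke_sheaf K" "v \<in> nodes K" "\<forall>x. f x \<in> dom (str K v)"
      and \<Gamma>: "\<forall>\<phi>\<in>Th \<union> ST x ` \<Gamma>. fosat K \<phi> v f" and \<Delta>: "\<forall>\<psi>\<in>ST x ` \<Delta>. \<not> fosat K \<psi> v f"
    interpret sheaf K by unfold_locales (rule K)
    interpret Th_sheaf K v f
      by unfold_locales (use K \<Gamma> in \<open>auto simp: asg_def\<close>)
    interpret P: chellas pair_model by unfold_locales (rule chellas_pair_model)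
    have "(v, f x) \<in> worlds pair_model"
      using root_cone K(3) by (simp add: pair_model_simps pairs_def)
    \<comment> \<open>The pair model lives on \<open>'v \<times> 'a\<close>; its countable submodel
      can be carried over to the unrelated type \<open>'w\<close>.\<close>
    then obtain N :: "'w chellas" and w where N: "chellas_model N" "w \<in> worlds N"
      "\<forall>\<phi>. sat N \<phi> w \<longleftrightarrow> sat pair_model \<phi> (v, f x)"
      by (rule P.countable_submodel)
    have "sat N \<phi> w \<longleftrightarrow> fosat K (ST x \<phi>) v f" for \<phi>
      using N(3) fosat_ST[OF root_cone asg_f] by simp
    then show False
      using chellas N(1,2) \<Gamma> \<Delta> unfolding chellas_entails_def by blast
  qed
next
  assume fo: "fo_entails TYPE('v) TYPE('a) (Th \<union> ST x ` \<Gamma>) (ST x ` \<Delta>)"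
  show "chellas_entails TYPE('w) \<Gamma> \<Delta>"
    unfolding chellas_entails_def
  proof (intro notI; elim exE conjE)
    fix M :: "'w chellas" and w
    assume M: "chellas_model M" "w \<in> worlds M"
      and \<Gamma>: "\<forall>\<phi>\<in>\<Gamma>. sat M \<phi> w" and \<Delta>: "\<forall>\<psi>\<in>\<Delta>. \<not> sat M \<psi> w"
    interpret chellas M by unfold_locales (rule M)
    \<comment> \<open>The type \<open>nat\<close> meets the countability demand that
      \<open>sheaf_of_chellas\<close> places on worlds.\<close>
    obtain N :: "nat chellas" and n where N: "chellas_model N" "n \<in> worlds N"
      "\<forall>\<phi>. sat N \<phi> n \<longleftrightarrow> sat M \<phi> w"
      using M(2) by (rule countable_submodel)
    obtain K :: "('v, 'a) sheaf" and y g where K: "kripke_sheaf K" "y \<in> nodes K"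
      "\<forall>x. g x \<in> dom (str K y)" "\<forall>\<phi>\<in>Th. fosat K \<phi> y g"
      "\<forall>x \<phi>. fosat K (ST x \<phi>) y g \<longleftrightarrow> sat N \<phi> n"
      using N(1,2) by (rule sheaf_of_chellas)
    show False
      using fo K \<Gamma> \<Delta> N(3) unfolding fo_entails_def by blast
  qed
qed

end
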